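(* CCGs and sCFTGs are strongly equivalent up to relabeling. That is: (1) for every CCG $\mathcal G$ and every category relabeling $\rho$ there exist an sCFTG $\mathcal G'$ and a relabeling $\pi$ with $\pi(T(\mathcal G')) = T_\rho(\mathcal G)$; and (2) for every sCFTG $\mathcal G$ there exist a CCG $\mathcal G'$, a category relabeling $\rho$ and a relabeling $\pi$ with $\pi(T_\rho(\mathcal G')) = T(\mathcal G)$.
   Context: Trees: a ranked alphabet is $\Sigma=\Sigma_0\cup\Sigma_1\cup\Sigma_2$ (symbols of rank 0,1,2); $T_{\Sigma_2,\Sigma_1}(\Sigma_0)$ is the set of trees over it. A context is a tree over $\Sigma$ with an extra leaf symbol $\Box$ occurring exactly once; $C[t]$ replaces $\Box$ by $t$. A relabeling is a rank-preserving map of symbols applied node-wise to trees. sCFTG: a tuple $\mathcal G=(N,\Sigma,S,P)$ with disjoint ranked alphabets $N=N_0\cup N_1$ (nullary and unary nonterminals) and $\Sigma$ with $\Sigma_1=\emptyset$, start symbol $S\in N_0$, and finite productions $P$ where each production is either $n\to r$ with $n\in N_0$ and $r\in T_{\Sigma_2,N_1}(N_0\cup\Sigma_0)$, or $n\to C$ with $n\in N_1$ and $C$ a context over $\Sigma_2, N_1, N_0\cup\Sigma_0$. A derivation step replaces an occurrence of $n\in N_0$ by $r$, or an occurrence of a subtree $n(t')$ with $n\in N_1$ by $C[t']$. $T(\mathcal G)$ is the set of trees in $T_{\Sigma_2,\emptyset}(\Sigma_0)$ derivable from $S$. CCG: given an alphabet $A$ of atoms and slashes $D=\{/,\backslash\}$,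 categories are binary trees with inner nodes in $D$ and leaves in $A$, written infix and left-associatively as $c=a|_1c_1\cdots|_kc_k$ with $a\in A$ (the target), arguments $|_ic_i$, and arity $k$. A forward rule of degree $k$ has the form $\frac{ax|_1c_1\cdots|_kc_k}{ax/c\quad c|_1c_1\cdots|_kc_k}$ and a backward rule $\frac{ax|_1c_1\cdots|_kc_k}{c|_1c_1\cdots|_kc_k\quad ax\backslash c}$, where $a\in A$, $c$ is a category or a category variable $y$, each $c_i$ is a category or category variable $y_i$, $|_i\in D$, and $x$ is a variable over argument sequences; a ground instance substitutes concrete categories/argument sequences. A CCG is $\mathcal G=(\Sigma,A,R,I,\mathcal L)$ with input alphabet $\Sigma$, finite rule set $R$, initial atoms $I\subseteq A$, and finite lexicon $\mathcal L\subseteq\Sigma\times$ categories. A derivation tree is a binary tree labeled by categories whose leaves are labeled by categories in $\mathcal L(\Sigma)$ and where each inner node labeled $c''$ with children labeled $c,c'$ (left to right) satisfies that $c''$ is obtained from $c,c'$ by a ground instance of a rule in $R$. A category relabeling is a map $\rho$ from categories to a ranked set such that $\rho(c)=\rho(c')$ whenever $c,c'$ have the same target and the same last argument; $T_\rho(\mathcal G)=\{\rho(t)\mid t$ a derivation tree of $\mathcal G$ with root label in $I\}$. *)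

theory Defs
  imports Main
begin

text \<open>The rank of a symbol occurrence is given by the node constructor:
  Leaf = rank 0, Node1 = rank 1, Node2 = rank 2.  A relabeling is applied
  node-wise via map_rtree.\<close>

datatype 'x rtree = Leaf 'x | Node1 'x "'x rtree" | Node2 'x "'x rtree" "'x rtree"

fun root :: "'x rtree \<Rightarrow> 'x" where
  "root (Leaf x) = x"
| "root (Node1 x _) = x"
| "root (Node2 x _ _) = x"

fun no_unary :: "'x rtree \<Rightarrow> bool" where
  "no_unary (Leaf _) = True"
| "no_unary (Node1 _ _) = False"
| "no_unary (Node2 _ l r) = (no_unary l \<and> no_unary r)"

datatype ('t, 'n) sym = T 't | NT 'n | Hole

record ('t, 'n) scftg =
  N0 :: "'n set"
  N1 :: "'n set"
  Sig0 :: "'t set"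
  Sig2 :: "'t set"
  start :: 'n
  P0 :: "('n \<times> ('t, 'n) sym rtree) set"
  P1 :: "('n \<times> ('t, 'n) sym rtree) set"

fun holes :: "('t, 'n) sym rtree \<Rightarrow> nat" where
  "holes (Leaf Hole) = 1"
| "holes (Leaf _) = 0"
| "holes (Node1 _ t) = holes t"
| "holes (Node2 _ l r) = holes l + holes r"

fun fill :: "('t, 'n) sym rtree \<Rightarrow> ('t, 'n) sym rtree \<Rightarrow> ('t, 'n) sym rtree" where
  "fill (Leaf Hole) t = t"
| "fill (Leaf x) t = Leaf x"
| "fill (Node1 x s) t = Node1 x (fill s t)"
| "fill (Node2 x l r) t = Node2 x (fill l t) (fill r t)"

fun rhs_ok :: "('t, 'n, 'z) scftg_scheme \<Rightarrow> ('t, 'n) sym rtree \<Rightarrow> bool" where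
  "rhs_ok G (Leaf (T s)) = (s \<in> Sig0 G)"
| "rhs_ok G (Leaf (NT n)) = (n \<in> N0 G)"
| "rhs_ok G (Leaf Hole) = True"
| "rhs_ok G (Node1 (NT n) t) = (n \<in> N1 G \<and> rhs_ok G t)"
| "rhs_ok G (Node1 _ _) = False"
| "rhs_ok G (Node2 (T s) l r) = (s \<in> Sig2 G \<and> rhs_ok G l \<and> rhs_ok G r)"
| "rhs_ok G (Node2 _ _ _) = False"

definition wf_scftg :: "('t, 'n, 'z) scftg_scheme \<Rightarrow> bool" where
  "wf_scftg G \<longleftrightarrow>
     finite (N0 G) \<and> finite (N1 G) \<and> finite (Sig0 G) \<and> finite (Sig2 G) \<and>
     N0 G \<inter> N1 G = {} \<and> Sig0 G \<inter> Sig2 G = {} \<and>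
     start G \<in> N0 G \<and> finite (P0 G) \<and> finite (P1 G) \<and>
     (\<forall>(n, r) \<in> P0 G. n \<in> N0 G \<and> rhs_ok G r \<and> holes r = 0) \<and>
     (\<forall>(n, C) \<in> P1 G. n \<in> N1 G \<and> rhs_ok G C \<and> holes C = 1)"

definition scftg_step :: "('t, 'n, 'z) scftg_scheme \<Rightarrow> ('t, 'n) sym rtree \<Rightarrow> ('t, 'n) sym rtree \<Rightarrow> bool" where
  "scftg_step G s s' \<longleftrightarrow>
     (\<exists>D n r. holes D = 1 \<and> (n, r) \<in> P0 G \<and>
        s = fill D (Leaf (NT n)) \<and> s' = fill D r) \<or>
     (\<exists>D n C t'. holes D = 1 \<and> (n, C) \<in> P1 G \<and>
        s = fill D (Node1 (NT n) t') \<and> s' = fill D (fill C t'))"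

definition scftg_lang :: "('t, 'n, 'z) scftg_scheme \<Rightarrow> 't rtree set" where
  "scftg_lang G = {t. no_unary t \<and>
      (scftg_step G)\<^sup>*\<^sup>* (Leaf (NT (start G))) (map_rtree T t)}"

datatype slash = FSl | BSl

datatype 'b cat = Atom 'b | Slash slash "'b cat" "'b cat"

fun target :: "'b cat \<Rightarrow> 'b" where
  "target (Atom a) = a"
| "target (Slash _ c _) = target c"

fun last_arg :: "'b cat \<Rightarrow> (slash \<times> 'b cat) option" where
  "last_arg (Atom a) = None"
| "last_arg (Slash d _ c) = Some (d, c)"

fun cat_atoms :: "'b cat \<Rightarrow> 'b set" where
  "cat_atoms (Atom a) = {a}"
| "cat_atoms (Slash _ c c') = cat_atoms c \<union> cat_atoms c'"

definition app_args :: "'b cat \<Rightarrow> (slash \<times> 'b cat) list \<Rightarrow> 'b cat" where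
  "app_args c xs = foldl (\<lambda>c (d, c'). Slash d c c') c xs"

datatype dir = Fw | Bw

text \<open>A rule: direction, target atom a, the category c (None = variable y),
  and the arguments |_i c_i (None = variable y_i).\<close>
type_synonym 'b ccg_rule = "dir \<times> 'b \<times> 'b cat option \<times> (slash \<times> 'b cat option) list"

definition ground_inst :: "'b ccg_rule \<Rightarrow> 'b cat \<Rightarrow> 'b cat \<Rightarrow> 'b cat \<Rightarrow> bool" where
  "ground_inst rl cl cr c \<longleftrightarrow>
     (case rl of (dr, a, cp, args) \<Rightarrow>
       (\<exists>x y ys. length ys = length args \<and>
          (\<forall>c0. cp = Some c0 \<longrightarrow> y = c0) \<and>
          (\<forall>i < length args. \<forall>c0. snd (args ! i) = Some c0 \<longrightarrow> ys ! i = c0) \<and>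
          c = app_args (Atom a) (x @ zip (map fst args) ys) \<and>
          (case dr of
             Fw \<Rightarrow> cl = app_args (Atom a) (x @ [(FSl, y)]) \<and>
                   cr = app_args y (zip (map fst args) ys)
           | Bw \<Rightarrow> cl = app_args y (zip (map fst args) ys) \<and>
                   cr = app_args (Atom a) (x @ [(BSl, y)]))))"

record ('a, 'b) ccg =
  inp :: "'a set"
  atoms :: "'b set"
  rules :: "'b ccg_rule set"
  init :: "'b set"
  lex :: "('a \<times> 'b cat) set"

definition rule_atoms :: "'b ccg_rule \<Rightarrow> 'b set" where
  "rule_atoms rl = (case rl of (dr, a, cp, args) \<Rightarrow>
     {a} \<union> (\<Union>c\<in>set_option cp. cat_atoms c) \<union>
     (\<Union>(d, co)\<in>set args. \<Union>c\<in>set_option co. cat_atoms c))"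

definition wf_ccg :: "('a, 'b, 'z) ccg_scheme \<Rightarrow> bool" where
  "wf_ccg G \<longleftrightarrow>
     finite (inp G) \<and> finite (atoms G) \<and> finite (rules G) \<and> finite (lex G) \<and>
     init G \<subseteq> atoms G \<and>
     (\<forall>(s, c) \<in> lex G. s \<in> inp G \<and> cat_atoms c \<subseteq> atoms G) \<and>
     (\<forall>rl \<in> rules G. rule_atoms rl \<subseteq> atoms G)"

inductive ccg_deriv :: "('a, 'b, 'z) ccg_scheme \<Rightarrow> 'b cat rtree \<Rightarrow> bool" for G where
  leaf: "(s, c) \<in> lex G \<Longrightarrow> ccg_deriv G (Leaf c)"
| bin: "ccg_deriv G l \<Longrightarrow> ccg_deriv G r \<Longrightarrow> rl \<in> rules G \<Longrightarrow>
        ground_inst rl (root l) (root r) c \<Longrightarrow> ccg_deriv G (Node2 c l r)"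

definition cat_relabeling :: "('b cat \<Rightarrow> 'c) \<Rightarrow> bool" where
  "cat_relabeling \<rho> \<longleftrightarrow>
     (\<forall>c c'. target c = target c' \<and> last_arg c = last_arg c' \<longrightarrow> \<rho> c = \<rho> c')"

definition ccg_lang :: "('a, 'b, 'z) ccg_scheme \<Rightarrow> ('b cat \<Rightarrow> 'c) \<Rightarrow> 'c rtree set" where
  "ccg_lang G \<rho> = {map_rtree \<rho> t | t. ccg_deriv G t \<and> (\<exists>a \<in> init G. root t = Atom a)}"

end

theory Submission
  imports Defs
begin

text \<open>
  From CCGs to sCFTGs: along a spine of a CCG derivation the argument sequence behaves like a
  pushdown store. A unary nonterminal generates the spine segments that remove the topmost argument,
  a nullary nonterminal the derivation trees with a given root category of bounded length.

  From sCFTGs to CCGs: every spine, read upwards, is generated by a context-free grammar. It is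
  brought into a form of Greibach normal form with at most two new stack symbols per step, in
  which every stack symbol is on top at exactly one node and can therefore carry its label.
  The stack symbols become atomic arguments. The secondary category of a rule
  application has to supply the new stack symbols; the lexicon places them, unused, at the bottom
  of the stack of the secondary spine.
\<close>

section \<open>Big-step semantics of sCFTGs\<close>

text \<open>Both directions must get by with finitely many symbols although the categories on a
  spine are unboundedly long. Towards sCFTGs this works because a rule application reads only the
  topmost argument of its primary category, while a secondary category is an argument of the lexicon
  extended by at most a rule degree and so has bounded length. Towards CCGs the obstacle is the
  relabeling, which sees only the target and the last argument. An application pops exactly one
  argument and builds exactly one node; this is why every process step must attach one node, as
  Greibach normal form provides. The popped argument also fixes the target of the secondary
  category, so the side tree must be announced when the symbol is pushed. The top node of a spine
  has no stack symbol left to show its label, which is therefore announced in the target. The bound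
  two arises when a step enters a production: one symbol for the rest of that production and one for
  the rest of its caller.\<close>

lemma fill_Hole [simp]: "fill C (Leaf Hole) = C"
proof (induction C)
  case (Leaf x)
  then show ?case by (cases x) auto
qed auto

lemma fill_assoc: "fill C (fill D t) = fill (fill C D) t"
proof (induction C)
  case (Leaf x)
  then show ?case by (cases x) auto
qed auto

lemma holes_fill: "holes (fill C t) = holes C * holes t"
proof (induction C)
  case (Leaf x)
  then show ?case by (cases x) auto
qed (auto simp: algebra_simps)

lemma fill_no_hole: "holes t = 0 \<Longrightarrow> fill t s = t"
proof (induction t)
  case (Leaf x)
  then show ?case by (cases x) auto
qed auto

lemma root_fill: "C \<noteq> Leaf Hole \<Longrightarrow> root (fill C t) = root C"
proof (cases C)
  case (Leaf x)
  then show "C \<noteq> Leaf Hole \<Longrightarrow> root (fill C t) = root C" by (cases x) auto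
qed auto

lemma holes_map_T [simp]: "holes (map_rtree T t) = 0"
  by (induction t) auto

text \<open>Body and argument of a unary nonterminal are evaluated independently. In a well-formed
  grammar a context has exactly one hole, so the argument is neither copied nor deleted, and this
  call-by-value reading yields the same terminal trees as rewriting in any order.
  \<open>Hole\<close> evaluates to itself, so that contexts need no relation of their own.\<close>

inductive ev :: "('t, 'n, 'z) scftg_scheme \<Rightarrow> ('t, 'n) sym rtree \<Rightarrow> ('t, 'n) sym rtree \<Rightarrow> bool"
  for G where
  ev_T: "ev G (Leaf (T s)) (Leaf (T s))"
| ev_Hole: "ev G (Leaf Hole) (Leaf Hole)"
| ev_NT0: "(n, r) \<in> P0 G \<Longrightarrow> ev G r t \<Longrightarrow> ev G (Leaf (NT n)) t"
| ev_NT1: "(n, C) \<in> P1 G \<Longrightarrow> ev G C D \<Longrightarrow> ev G s t \<Longrightarrow> ev G (Node1 (NT n) s) (fill D t)"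
| ev_Node2: "ev G l l' \<Longrightarrow> ev G r r' \<Longrightarrow> ev G (Node2 (T s) l r) (Node2 (T s) l' r')"

inductive_cases ev_HoleE: "ev G (Leaf Hole) t"
inductive_cases ev_Node1E: "ev G (Node1 x s) t"
inductive_cases ev_Node2E: "ev G (Node2 x l r) t"

lemma wf_P0: "wf_scftg G \<Longrightarrow> (n, r) \<in> P0 G \<Longrightarrow> n \<in> N0 G \<and> rhs_ok G r \<and> holes r = 0"
  unfolding wf_scftg_def by auto

lemma wf_P1: "wf_scftg G \<Longrightarrow> (n, C) \<in> P1 G \<Longrightarrow> n \<in> N1 G \<and> rhs_ok G C \<and> holes C = 1"
  unfolding wf_scftg_def by auto

lemma ev_holes:
  assumes "wf_scftg G" "ev G s t"
  shows "holes t = holes s"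
  using assms(2)
  by (induction) (auto simp: holes_fill dest: wf_P0[OF assms(1)] wf_P1[OF assms(1)])

lemma ev_fill:
  assumes "wf_scftg G" "ev G C D" "ev G s t"
  shows "ev G (fill C s) (fill D t)"
  using assms(2)
proof (induction)
  case (ev_NT0 n r u)
  have "holes u = 0"
    using ev_holes[OF assms(1) ev_NT0(2)] wf_P0[OF assms(1) ev_NT0(1)] by simp
  then show ?case using ev_NT0 by (auto simp: fill_no_hole intro: ev.intros)
next
  case (ev_NT1 n E F s' t')
  then show ?case by (auto simp: fill_assoc[symmetric] intro: ev.intros)
qed (auto intro: ev.intros assms(3))

text \<open>Converse of \<open>ev_fill\<close>. The single hole matters: two copies of
  \<open>s\<close> could evaluate differently, and with no copy there would be no evaluation of
  \<open>s\<close> to return.\<close>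

lemma ev_fillE:
  assumes "wf_scftg G" "holes C = 1" "ev G (fill C s) t"
  obtains D u where "ev G C D" "ev G s u" "t = fill D u"
proof -
  have "\<exists>D u. ev G C D \<and> ev G s u \<and> t = fill D u" if "holes C = 1" "ev G (fill C s) t" for t
    using that
  proof (induction C arbitrary: t)
    case (Leaf x)
    then show ?case by (cases x) (auto intro: ev.intros exI[of _ "Leaf Hole"])
  next
    case (Node1 x C)
    from Node1.prems(2) obtain n E F u where
      x: "x = NT n" "(n, E) \<in> P1 G" "ev G E F" "ev G (fill C s) u" "t = fill F u"
      by (auto elim: ev_Node1E)
    from Node1.IH[OF _ x(4)] Node1.prems(1) obtain D u' where
      "ev G C D" "ev G s u'" "u = fill D u'" by auto
    with x show ?case by (metis ev_NT1 fill_assoc)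
  next
    case (Node2 x l r)
    from Node2.prems(2) obtain a l' r' where
      x: "x = T a" "ev G (fill l s) l'" "ev G (fill r s) r'" "t = Node2 x l' r'"
      by (auto elim: ev_Node2E)
    consider "holes l = 1" "holes r = 0" | "holes l = 0" "holes r = 1"
      using Node2.prems(1) by (auto simp: add_is_1)
    then show ?case
    proof cases
      case 1
      from Node2.IH(1)[OF 1(1) x(2)] obtain D u where
        D: "ev G l D" "ev G s u" "l' = fill D u" by auto
      have r: "ev G r r'" using x(3) 1(2) by (simp add: fill_no_hole)
      have "holes r' = 0" using ev_holes[OF assms(1) r] 1(2) by simp
      then have "t = fill (Node2 (T a) D r') u" using x D by (simp add: fill_no_hole)
      with D r x(1) show ?thesis by (blast intro: ev.intros)
    next
      case 2
      from Node2.IH(2)[OF 2(2) x(3)] obtain D u where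
        D: "ev G r D" "ev G s u" "r' = fill D u" by auto
      have l: "ev G l l'" using x(2) 2(1) by (simp add: fill_no_hole)
      have "holes l' = 0" using ev_holes[OF assms(1) l] 2(1) by simp
      then have "t = fill (Node2 (T a) l' D) u" using x D by (simp add: fill_no_hole)
      with D l x(1) show ?thesis by (blast intro: ev.intros)
    qed
  qed
  with assms(2,3) that show thesis by blast
qed

lemma step_fill:
  assumes "scftg_step G s s'" "holes C = 1"
  shows "scftg_step G (fill C s) (fill C s')"
  using assms unfolding scftg_step_def
  by (metis fill_assoc holes_fill mult_1)

lemma steps_fill:
  assumes "(scftg_step G)\<^sup>*\<^sup>* s s'" "holes C = 1"
  shows "(scftg_step G)\<^sup>*\<^sup>* (fill C s) (fill C s')"
  using assms(1) by induction (auto intro: rtranclp.rtrancl_into_rtrancl step_fill assms(2))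

text \<open>A rewriting step needs a surrounding context with exactly one hole, so a form cannot be
  rewritten next to a sibling that has a hole itself. Plugging a hole-free \<open>s\<close>
  throughout the induction keeps the count right.\<close>

lemma ev_steps_fill:
  assumes wf: "wf_scftg G" and "ev G X t" "holes X \<le> 1" "holes s = 0"
  shows "(scftg_step G)\<^sup>*\<^sup>* (fill X s) (fill t s)"
  using assms(2-)
proof (induction arbitrary: s)
  case (ev_NT0 n r u)
  have "scftg_step G (fill (Leaf Hole) (Leaf (NT n))) (fill (Leaf Hole) r)"
    unfolding scftg_step_def using ev_NT0(1) by (metis holes.simps(1))
  moreover have "(scftg_step G)\<^sup>*\<^sup>* (fill r s) (fill u s)" "fill r s = r"
    using ev_NT0 wf_P0[OF wf ev_NT0(1)] by (auto simp: fill_no_hole)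
  ultimately show ?case by simp
next
  case (ev_NT1 n C D X t)
  have C: "holes C = 1" "holes D = 1"
    using wf_P1[OF wf ev_NT1(1)] ev_holes[OF wf ev_NT1(2)] by auto
  have "scftg_step G (fill (Leaf Hole) (Node1 (NT n) (fill X s))) (fill (Leaf Hole) (fill C (fill X s)))"
    unfolding scftg_step_def using ev_NT1(1) by (metis holes.simps(1))
  moreover have "(scftg_step G)\<^sup>*\<^sup>* (fill C (fill X s)) (fill D (fill X s))"
    using ev_NT1 C by (simp add: holes_fill)
  moreover have "(scftg_step G)\<^sup>*\<^sup>* (fill D (fill X s)) (fill D (fill t s))"
    using ev_NT1 C by (intro steps_fill) auto
  ultimately show ?case by (simp add: fill_assoc[symmetric])
next
  case (ev_Node2 l l' r r' a)
  have "(scftg_step G)\<^sup>*\<^sup>* (fill (Node2 (T a) (Leaf Hole) (fill r s)) (fill l s))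
      (fill (Node2 (T a) (Leaf Hole) (fill r s)) (fill l' s))"
    using ev_Node2 by (intro steps_fill) (auto simp: holes_fill)
  moreover have "(scftg_step G)\<^sup>*\<^sup>* (fill (Node2 (T a) (fill l' s) (Leaf Hole)) (fill r s))
      (fill (Node2 (T a) (fill l' s) (Leaf Hole)) (fill r' s))"
    using ev_Node2 by (intro steps_fill) (auto simp: holes_fill)
  ultimately show ?case using ev_Node2.prems by (simp add: fill_no_hole holes_fill)
qed auto

lemma step_ev:
  assumes wf: "wf_scftg G" and "scftg_step G s s'" "ev G s' t"
  shows "ev G s t"
  using assms(2) unfolding scftg_step_def
proof (elim disjE exE conjE)
  fix D n r assume *: "holes D = 1" "(n, r) \<in> P0 G" "s = fill D (Leaf (NT n))" "s' = fill D r"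
  from ev_fillE[OF wf *(1)] assms(3) *(4) obtain E u where "ev G D E" "ev G r u" "t = fill E u"
    by metis
  then show ?thesis using * by (auto intro: ev_fill[OF wf] ev.intros)
next
  fix D n C t' assume *: "holes D = 1" "(n, C) \<in> P1 G" "s = fill D (Node1 (NT n) t')"
    "s' = fill D (fill C t')"
  from ev_fillE[OF wf *(1)] assms(3) *(4) obtain E u where
    E: "ev G D E" "ev G (fill C t') u" "t = fill E u" by metis
  have "holes C = 1" using wf_P1[OF wf *(2)] by simp
  from ev_fillE[OF wf this E(2)] obtain F v where "ev G C F" "ev G t' v" "u = fill F v" .
  then show ?thesis using * E by (auto intro: ev_fill[OF wf] ev.intros)
qed

lemma ev_terminal: "no_unary t \<Longrightarrow> ev G (map_rtree T t) (map_rtree T t)"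
  by (induction t) (auto intro: ev.intros)

lemma scftg_lang_iff_ev:
  assumes wf: "wf_scftg G"
  shows "t \<in> scftg_lang G \<longleftrightarrow> no_unary t \<and> ev G (Leaf (NT (start G))) (map_rtree T t)"
proof -
  let ?s = "Leaf (NT (start G))"
  have "ev G s (map_rtree T t)" if "(scftg_step G)\<^sup>*\<^sup>* s (map_rtree T t)" "no_unary t" for s
    using that by (induction rule: converse_rtranclp_induct) (auto intro: ev_terminal step_ev[OF wf])
  moreover have "(scftg_step G)\<^sup>*\<^sup>* ?s (map_rtree T t)" if "ev G ?s (map_rtree T t)"
    using ev_steps_fill[OF wf that, of "map_rtree T t"] by (simp add: fill_no_hole)
  ultimately show ?thesis unfolding scftg_lang_def by auto
qed

section \<open>Categories as argument stacks\<close>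

lemma app_args_append [simp]: "app_args c (xs @ ys) = app_args (app_args c xs) ys"
  by (simp add: app_args_def)

lemma app_args_Nil [simp]: "app_args c [] = c"
  by (simp add: app_args_def)

lemma app_args_Cons [simp]: "app_args c ((d, e) # xs) = app_args (Slash d c e) xs"
  by (simp add: app_args_def)

lemma target_app_args [simp]: "target (app_args c xs) = target c"
  by (induction xs rule: rev_induct) auto

lemma last_arg_app_args: "last_arg (app_args c xs) = (if xs = [] then last_arg c else Some (last xs))"
  by (induction xs rule: rev_induct) auto

lemma app_args_Atom_neq: "xs \<noteq> [] \<Longrightarrow> app_args (Atom a) xs \<noteq> Atom b"
  by (induction xs rule: rev_induct) auto

lemma app_args_inject [simp]:
  "app_args (Atom a) xs = app_args (Atom b) ys \<longleftrightarrow> a = b \<and> xs = ys"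
proof (induction xs arbitrary: ys rule: rev_induct)
  case Nil
  then show ?case using app_args_Atom_neq[of ys b a] by (cases "ys = []") auto
next
  case (snoc x xs)
  show ?case
  proof (cases ys rule: rev_cases)
    case Nil
    then show ?thesis by (cases x) auto
  next
    case (snoc ys' y)
    with snoc.IH[of ys'] show ?thesis by (cases x; cases y) auto
  qed
qed

fun cat_args :: "'b cat \<Rightarrow> (slash \<times> 'b cat) list" where
  "cat_args (Atom a) = []"
| "cat_args (Slash d c e) = cat_args c @ [(d, e)]"

lemma app_args_cat_args [simp]: "app_args (Atom (target c)) (cat_args c) = c"
  by (induction c) auto

lemma cat_args_app_args [simp]: "cat_args (app_args c xs) = cat_args c @ xs"
  by (induction xs arbitrary: c) auto

fun slash_of :: "dir \<Rightarrow> slash" where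
  "slash_of Fw = FSl"
| "slash_of Bw = BSl"

text \<open>The child that continues the spine comes first, whatever its side.\<close>
fun mk_node :: "dir \<Rightarrow> 'x \<Rightarrow> 'x rtree \<Rightarrow> 'x rtree \<Rightarrow> 'x rtree" where
  "mk_node Fw x p q = Node2 x p q"
| "mk_node Bw x p q = Node2 x q p"

text \<open>Isolates what a rule constrains from the argument sequence \<open>x\<close>, which it
  leaves free. The roles of primary and secondary category replace left and right.\<close>

definition rule_inst :: "'b ccg_rule \<Rightarrow> dir \<Rightarrow> 'b \<Rightarrow> 'b cat \<Rightarrow> (slash \<times> 'b cat) list \<Rightarrow> bool" where
  "rule_inst rl dr a c es \<longleftrightarrow> (\<exists>cp args. rl = (dr, a, cp, args) \<and> map fst es = map fst args \<and>
     (\<forall>c0. cp = Some c0 \<longrightarrow> c = c0) \<and>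
     (\<forall>i < length args. \<forall>c0. snd (args ! i) = Some c0 \<longrightarrow> snd (es ! i) = c0))"

lemma ground_instE:
  assumes "ground_inst rl cl cr r"
  obtains dr a x c es where "rule_inst rl dr a c es" "r = app_args (Atom a) (x @ es)"
    "dr = Fw \<Longrightarrow> cl = app_args (Atom a) (x @ [(FSl, c)]) \<and> cr = app_args c es"
    "dr = Bw \<Longrightarrow> cr = app_args (Atom a) (x @ [(BSl, c)]) \<and> cl = app_args c es"
proof -
  obtain dr a cp args where rl: "rl = (dr, a, cp, args)" by (cases rl)
  from assms obtain x y ys where *: "length ys = length args"
    "\<forall>c0. cp = Some c0 \<longrightarrow> y = c0" "\<forall>i < length args. \<forall>c0. snd (args ! i) = Some c0 \<longrightarrow> ys ! i = c0"
    "r = app_args (Atom a) (x @ zip (map fst args) ys)"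
    "dr = Fw \<Longrightarrow> cl = app_args (Atom a) (x @ [(FSl, y)]) \<and> cr = app_args y (zip (map fst args) ys)"
    "dr = Bw \<Longrightarrow> cr = app_args (Atom a) (x @ [(BSl, y)]) \<and> cl = app_args y (zip (map fst args) ys)"
    unfolding ground_inst_def rl by (cases dr) auto
  show thesis
    by (rule that[of dr a y "zip (map fst args) ys" x]) (use * rl in \<open>auto simp: rule_inst_def\<close>)
qed

lemma ground_instI:
  assumes "rule_inst rl dr a c es"
  shows "dr = Fw \<Longrightarrow> ground_inst rl (app_args (Atom a) (x @ [(FSl, c)])) (app_args c es) (app_args (Atom a) (x @ es))"
    and "dr = Bw \<Longrightarrow> ground_inst rl (app_args c es) (app_args (Atom a) (x @ [(BSl, c)])) (app_args (Atom a) (x @ es))"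
proof -
  from assms obtain cp args where *: "rl = (dr, a, cp, args)" "map fst es = map fst args"
    "\<forall>c0. cp = Some c0 \<longrightarrow> c = c0"
    "\<forall>i < length args. \<forall>c0. snd (args ! i) = Some c0 \<longrightarrow> snd (es ! i) = c0"
    unfolding rule_inst_def by auto
  have l: "length es = length args" using *(2) by (metis length_map)
  have es: "zip (map fst args) (map snd es) = es"
    unfolding *(2)[symmetric] by (simp add: zip_map_fst_snd)
  show "ground_inst rl (app_args (Atom a) (x @ [(FSl, c)])) (app_args c es) (app_args (Atom a) (x @ es))" if "dr = Fw"
    unfolding ground_inst_def * that prod.case dir.case
    by (rule exI[of _ x], rule exI[of _ c], rule exI[of _ "map snd es"]) (use l es * in auto)
  show "ground_inst rl (app_args c es) (app_args (Atom a) (x @ [(BSl, c)])) (app_args (Atom a) (x @ es))" if "dr = Bw"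
    unfolding ground_inst_def * that prod.case dir.case
    by (rule exI[of _ x], rule exI[of _ c], rule exI[of _ "map snd es"]) (use l es * in auto)
qed

lemma ccg_deriv_step:
  assumes "ccg_deriv G p" "ccg_deriv G q" "rl \<in> rules G" "rule_inst rl dr a c es"
    "root p = app_args (Atom a) (x @ [(slash_of dr, c)])" "root q = app_args c es"
  shows "ccg_deriv G (mk_node dr (app_args (Atom a) (x @ es)) p q)"
  using assms ground_instI[OF assms(4), of x] by (cases dr) (auto intro: ccg_deriv.intros)

text \<open>Induction along spines: \<open>p\<close> is the primary child on whichever side it
  stands, so forward and backward rules share one case.\<close>

lemma ccg_deriv_stack_induct [consumes 1, case_names lex step]:
  assumes "ccg_deriv G d"
    and "\<And>s c. (s, c) \<in> lex G \<Longrightarrow> Q (Leaf c)"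
    and "\<And>p q rl dr a c es x. ccg_deriv G p \<Longrightarrow> Q p \<Longrightarrow> ccg_deriv G q \<Longrightarrow> Q q \<Longrightarrow>
      rl \<in> rules G \<Longrightarrow> rule_inst rl dr a c es \<Longrightarrow>
      root p = app_args (Atom a) (x @ [(slash_of dr, c)]) \<Longrightarrow> root q = app_args c es \<Longrightarrow>
      Q (mk_node dr (app_args (Atom a) (x @ es)) p q)"
  shows "Q d"
  using assms(1)
proof induction
  case (leaf s c)
  then show ?case by (rule assms(2))
next
  case (bin l r rl c)
  from bin.hyps(4) obtain dr a x c' es where *: "rule_inst rl dr a c' es" "c = app_args (Atom a) (x @ es)"
    "dr = Fw \<Longrightarrow> root l = app_args (Atom a) (x @ [(FSl, c')]) \<and> root r = app_args c' es"
    "dr = Bw \<Longrightarrow> root r = app_args (Atom a) (x @ [(BSl, c')]) \<and> root l = app_args c' es"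
    by (rule ground_instE) blast
  show ?case
  proof (cases dr)
    case Fw
    with assms(3)[of l r rl dr a c' es x] bin * show ?thesis by simp
  next
    case Bw
    with assms(3)[of r l rl dr a c' es x] bin * show ?thesis by simp
  qed
qed

lemma root_mk_node [simp]: "root (mk_node dr x p q) = x"
  by (cases dr) auto

lemma ccg_deriv_no_unary: "ccg_deriv G d \<Longrightarrow> no_unary d"
  by (induction rule: ccg_deriv.induct) auto

section \<open>From CCGs to sCFTGs\<close>

locale ccg =
  fixes G :: "('a, 'b) ccg"
  assumes wf: "wf_ccg G"
begin

definition targets :: "'b set" where
  "targets = target ` snd ` lex G"

definition lex_args :: "(slash \<times> 'b cat) set" where
  "lex_args = (\<Union>c \<in> snd ` lex G. set (cat_args c))"

text \<open>Sums serve as upper bounds for maxima. The first covers lexical categories; the second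
  and third together cover a lexical argument followed by the arguments of a rule, which is the
  shape of a secondary category.\<close>

definition bound :: nat where
  "bound = (\<Sum>e \<in> lex G. length (cat_args (snd e))) + (\<Sum>e \<in> lex_args. length (cat_args (snd e))) +
     (\<Sum>rl \<in> rules G. length (snd (snd (snd rl))))"

definition cats :: "'b cat set" where
  "cats = {c. target c \<in> targets \<and> set (cat_args c) \<subseteq> lex_args \<and> length (cat_args c) \<le> bound}"

definition tops :: "(slash \<times> 'b cat) option set" where
  "tops = insert None (Some ` lex_args)"

definition inst :: "dir \<Rightarrow> 'b \<Rightarrow> 'b cat \<Rightarrow> (slash \<times> 'b cat) list \<Rightarrow> bool" where
  "inst dr a c es \<longleftrightarrow> (\<exists>rl \<in> rules G. rule_inst rl dr a c es)"

lemma finite_targets: "finite targets"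
  using wf by (simp add: targets_def wf_ccg_def)

lemma finite_lex_args: "finite lex_args"
  using wf by (simp add: lex_args_def wf_ccg_def)

lemma finite_tops: "finite tops"
  by (simp add: tops_def finite_lex_args)

lemma finite_stacks: "finite {z. set z \<subseteq> lex_args \<and> length z \<le> bound}"
  by (rule finite_lists_length_le) (rule finite_lex_args)

lemma finite_cats: "finite cats"
proof (rule finite_subset)
  show "cats \<subseteq> (\<lambda>(a, z). app_args (Atom a) z) ` (targets \<times> {z. set z \<subseteq> lex_args \<and> length z \<le> bound})"
  proof
    fix c assume "c \<in> cats"
    then show "c \<in> (\<lambda>(a, z). app_args (Atom a) z) ` (targets \<times> {z. set z \<subseteq> lex_args \<and> length z \<le> bound})"
      by (intro image_eqI[of _ _ "(target c, cat_args c)"]) (auto simp: cats_def)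
  qed
qed (use finite_targets finite_stacks in auto)

text \<open>Rules only move arguments: the target and \<open>x\<close> come from the primary
  category and \<open>es\<close> from the secondary one, so everything stems from the
  lexicon.\<close>

lemma deriv_range:
  "ccg_deriv G d \<Longrightarrow> target (root d) \<in> targets \<and> set (cat_args (root d)) \<subseteq> lex_args"
proof (induction rule: ccg_deriv_stack_induct)
  case (lex s c)
  then show ?case by (force simp: targets_def lex_args_def)
qed auto

lemma lex_cats: "(s, c) \<in> lex G \<Longrightarrow> c \<in> cats"
proof -
  assume s: "(s, c) \<in> lex G"
  have "length (cat_args (snd (s, c))) \<le> (\<Sum>e \<in> lex G. length (cat_args (snd e)))"
    using wf by (intro member_le_sum[OF s]) (auto simp: wf_ccg_def)
  then show "c \<in> cats" using deriv_range[OF ccg_deriv.leaf[OF s]] by (simp add: cats_def bound_def)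
qed

lemma secondary_cats:
  assumes "inst dr a c es" "(sl, c) \<in> lex_args" "ccg_deriv G d" "root d = app_args c es"
  shows "app_args c es \<in> cats"
proof -
  from assms(1) obtain rl where rl: "rl \<in> rules G" "rule_inst rl dr a c es" by (auto simp: inst_def)
  have "length es = length (snd (snd (snd rl)))"
    using rl(2) by (auto simp: rule_inst_def dest: map_eq_imp_length_eq)
  also have "\<dots> \<le> (\<Sum>rl \<in> rules G. length (snd (snd (snd rl))))"
    using wf by (intro member_le_sum[OF rl(1)]) (auto simp: wf_ccg_def)
  finally have "length es \<le> (\<Sum>rl \<in> rules G. length (snd (snd (snd rl))))" .
  moreover have "length (cat_args (snd (sl, c))) \<le> (\<Sum>e \<in> lex_args. length (cat_args (snd e)))"
    by (intro member_le_sum[OF assms(2)]) (auto simp: finite_lex_args)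
  ultimately show ?thesis using deriv_range[OF assms(3)] assms(4) by (simp add: cats_def bound_def)
qed

end

section \<open>The grammar of spine segments\<close>

definition top_arg :: "'x option \<Rightarrow> 'x list \<Rightarrow> 'x option" where
  "top_arg l es = (if es = [] then l else Some (last es))"

lemma top_arg_append [simp]: "top_arg (top_arg l x) y = top_arg l (x @ y)"
  by (simp add: top_arg_def)

lemma top_arg_Nil [simp]: "top_arg l [] = l"
  by (simp add: top_arg_def)

lemma top_arg_Cons [simp]: "top_arg l (v # vs) = top_arg (Some v) vs"
  by (simp add: top_arg_def)

lemma last_arg_eq_top_arg: "last_arg (app_args (Atom a) z) = top_arg None z"
  by (simp add: top_arg_def last_arg_app_args)

text \<open>The nullary nonterminal \<open>nc c\<close> generates the derivation trees with root category \<open>c\<close>. The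
  unary nonterminal \<open>nu (a, l, v)\<close> generates the spine segments that start at a category
  \<open>a x v\<close>, with \<open>l\<close> the last argument of \<open>x\<close>, and end where \<open>a x\<close> is first reached. Leaves and
  inner nodes need different symbols \<open>tl\<close> and \<open>ti\<close>.\<close>
locale ccg_scftg = ccg G for G :: "('a, 'b) ccg" +
  fixes nc :: "'b cat \<Rightarrow> nat" and nu :: "'b \<times> (slash \<times> 'b cat) option \<times> (slash \<times> 'b cat) \<Rightarrow> nat"
    and tl ti :: "'b \<times> (slash \<times> 'b cat) option \<Rightarrow> nat"
    and n0 :: nat
  assumes inj_nc: "inj_on nc cats" and inj_nu: "inj_on nu (targets \<times> tops \<times> lex_args)"
    and disj: "nc ` cats \<inter> nu ` (targets \<times> tops \<times> lex_args) = {}" "n0 \<notin> nc ` cats"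
      "n0 \<notin> nu ` (targets \<times> tops \<times> lex_args)" "tl ` (targets \<times> tops) \<inter> ti ` (targets \<times> tops) = {}"
begin

text \<open>The last argument is on top and must go first, so its nonterminal is innermost, next to
  \<open>t\<close>. The middle component given to \<open>nu\<close> is the argument just below the
  removed one: it becomes the last argument after the removal and then determines a label.\<close>

fun wrap :: "'b \<Rightarrow> (slash \<times> 'b cat) option \<Rightarrow> (slash \<times> 'b cat) list \<Rightarrow> (nat, nat) sym rtree \<Rightarrow> (nat, nat) sym rtree" where
  "wrap a l [] t = t"
| "wrap a l (v # vs) t = Node1 (NT (nu (a, l, v))) (wrap a (Some v) vs t)"

definition prods_start :: "(nat \<times> (nat, nat) sym rtree) set" where
  "prods_start = {(n0, Leaf (NT (nc (Atom a)))) | a. a \<in> init G \<and> Atom a \<in> cats}"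

definition prods_lex :: "(nat \<times> (nat, nat) sym rtree) set" where
  "prods_lex = {(nc (app_args (Atom a) z), wrap a (top_arg None z) vs (Leaf (T (tl (a, top_arg None (z @ vs)))))) | a z vs.
     \<exists>s. (s, app_args (Atom a) (z @ vs)) \<in> lex G}"

text \<open>The root category is cut inside the arguments contributed by this step:
  \<open>es1\<close> survives to the root, and \<open>es2\<close> is removed further up the spine.
  Since \<open>es1\<close> is nonempty, the primary category \<open>x\<close> followed by
  \<open>c\<close> is no longer than the root category and stays within
  \<open>bound\<close>.\<close>

definition prods_inner :: "(nat \<times> (nat, nat) sym rtree) set" where
  "prods_inner = {(nc (app_args (Atom a) (x @ es1)), wrap a (top_arg None (x @ es1)) es2
     (mk_node dr (T (ti (a, top_arg None (x @ es1 @ es2)))) (Leaf (NT (nc (app_args (Atom a) (x @ [(slash_of dr, c)])))))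
       (Leaf (NT (nc (app_args c (es1 @ es2))))))) | dr a x c es1 es2.
     es1 \<noteq> [] \<and> inst dr a c (es1 @ es2) \<and> a \<in> targets \<and> set x \<subseteq> lex_args \<and> (slash_of dr, c) \<in> lex_args \<and>
     set (es1 @ es2) \<subseteq> lex_args \<and> length (x @ es1) \<le> bound \<and> app_args c (es1 @ es2) \<in> cats}"

definition prods_unary :: "(nat \<times> (nat, nat) sym rtree) set" where
  "prods_unary = {(nu (a, l, (slash_of dr, c)), wrap a l es
     (mk_node dr (T (ti (a, top_arg l es))) (Leaf Hole) (Leaf (NT (nc (app_args c es)))))) | dr a l c es.
     inst dr a c es \<and> a \<in> targets \<and> l \<in> tops \<and> (slash_of dr, c) \<in> lex_args \<and>
     set es \<subseteq> lex_args \<and> app_args c es \<in> cats}"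

definition scg :: "(nat, nat) scftg" where
  "scg = \<lparr>N0 = insert n0 (nc ` cats), N1 = nu ` (targets \<times> tops \<times> lex_args),
     Sig0 = tl ` (targets \<times> tops), Sig2 = ti ` (targets \<times> tops), start = n0,
     P0 = prods_start \<union> prods_lex \<union> prods_inner, P1 = prods_unary\<rparr>"

lemma scg_simps:
  "N0 scg = insert n0 (nc ` cats)" "N1 scg = nu ` (targets \<times> tops \<times> lex_args)"
  "Sig0 scg = tl ` (targets \<times> tops)" "Sig2 scg = ti ` (targets \<times> tops)" "start scg = n0"
  "P0 scg = prods_start \<union> prods_lex \<union> prods_inner" "P1 scg = prods_unary"
  by (simp_all add: scg_def)

lemma holes_wrap [simp]: "holes (wrap a l vs t) = holes t"
  by (induction vs arbitrary: l) auto

lemma wrap_fill: "wrap a l vs t = fill (wrap a l vs (Leaf Hole)) t"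
  by (induction vs arbitrary: l) auto

lemma wrap_append: "wrap a l (vs @ ws) t = wrap a l vs (wrap a (top_arg l vs) ws t)"
  by (induction vs arbitrary: l) auto

lemma top_arg_tops: "l \<in> tops \<Longrightarrow> set es \<subseteq> lex_args \<Longrightarrow> top_arg l es \<in> tops"
  using last_in_set[of es] unfolding top_arg_def tops_def by (auto intro!: imageI)

lemma None_tops: "None \<in> tops"
  by (simp add: tops_def)

lemma rhs_ok_wrap:
  assumes "a \<in> targets" "l \<in> tops" "set vs \<subseteq> lex_args" "rhs_ok scg t"
  shows "rhs_ok scg (wrap a l vs t)"
  using assms
proof (induction vs arbitrary: l)
  case (Cons v vs)
  then have "Some v \<in> tops" "nu (a, l, v) \<in> N1 scg" by (auto simp: tops_def scg_simps)
  with Cons show ?case by simp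
qed simp

lemma rhs_ok_mk_node:
  "rhs_ok scg (mk_node dr (T s) p q) \<longleftrightarrow> s \<in> Sig2 scg \<and> rhs_ok scg p \<and> rhs_ok scg q"
  by (cases dr) auto

lemma holes_mk_node [simp]: "holes (mk_node dr s p q) = holes p + holes q"
  by (cases dr) auto

lemma cats_prefix: "app_args (Atom a) (z @ vs) \<in> cats \<Longrightarrow> app_args (Atom a) z \<in> cats"
  by (simp add: cats_def)

lemma cats_app_args:
  "app_args (Atom a) z \<in> cats \<longleftrightarrow> a \<in> targets \<and> set z \<subseteq> lex_args \<and> length z \<le> bound"
  by (simp add: cats_def)

lemma prods_start_ok: "(n, r) \<in> prods_start \<Longrightarrow> n = n0 \<and> rhs_ok scg r \<and> holes r = 0"
  by (auto simp: prods_start_def scg_simps)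

lemma prods_lex_ok: "(n, r) \<in> prods_lex \<Longrightarrow> n \<in> nc ` cats \<and> rhs_ok scg r \<and> holes r = 0"
proof -
  assume "(n, r) \<in> prods_lex"
  then obtain a z vs s where *: "n = nc (app_args (Atom a) z)"
    "r = wrap a (top_arg None z) vs (Leaf (T (tl (a, top_arg None (z @ vs)))))"
    "(s, app_args (Atom a) (z @ vs)) \<in> lex G" unfolding prods_lex_def by blast
  have c: "app_args (Atom a) (z @ vs) \<in> cats" using lex_cats[OF *(3)] .
  then have "a \<in> targets" "set z \<subseteq> lex_args" "set vs \<subseteq> lex_args" unfolding cats_app_args by auto
  then show ?thesis using cats_prefix[OF c] top_arg_tops[OF None_tops, of z] top_arg_tops[OF None_tops, of "z @ vs"]
    unfolding * by (auto intro!: rhs_ok_wrap) (auto simp: scg_simps)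
qed

lemma prods_inner_ok: "(n, r) \<in> prods_inner \<Longrightarrow> n \<in> nc ` cats \<and> rhs_ok scg r \<and> holes r = 0"
proof -
  assume "(n, r) \<in> prods_inner"
  then obtain dr a x c es1 es2 where *: "n = nc (app_args (Atom a) (x @ es1))"
    "r = wrap a (top_arg None (x @ es1)) es2
     (mk_node dr (T (ti (a, top_arg None (x @ es1 @ es2)))) (Leaf (NT (nc (app_args (Atom a) (x @ [(slash_of dr, c)])))))
       (Leaf (NT (nc (app_args c (es1 @ es2))))))"
    "es1 \<noteq> []" "a \<in> targets" "set x \<subseteq> lex_args" "(slash_of dr, c) \<in> lex_args"
     "set (es1 @ es2) \<subseteq> lex_args" "length (x @ es1) \<le> bound" "app_args c (es1 @ es2) \<in> cats"
    unfolding prods_inner_def by blast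
  have "length (x @ [(slash_of dr, c)]) \<le> bound" using *(3,8) by (cases es1) auto
  then have "app_args (Atom a) (x @ [(slash_of dr, c)]) \<in> cats" "app_args (Atom a) (x @ es1) \<in> cats"
    unfolding cats_app_args using * by auto
  moreover have "top_arg None (x @ es1) \<in> tops" "top_arg None (x @ es1 @ es2) \<in> tops"
    using * by (auto intro!: top_arg_tops None_tops)
  ultimately show ?thesis using *(4-7,9) unfolding *(1,2)
    by (auto simp del: app_args_append simp: rhs_ok_mk_node intro!: rhs_ok_wrap) (auto simp: scg_simps)
qed

lemma prods_unary_ok: "(n, r) \<in> prods_unary \<Longrightarrow>
  n \<in> nu ` (targets \<times> tops \<times> lex_args) \<and> rhs_ok scg r \<and> holes r = 1"
proof -
  assume "(n, r) \<in> prods_unary"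
  then obtain dr a l c es where *: "n = nu (a, l, (slash_of dr, c))"
    "r = wrap a l es (mk_node dr (T (ti (a, top_arg l es))) (Leaf Hole) (Leaf (NT (nc (app_args c es)))))"
    "a \<in> targets" "l \<in> tops" "(slash_of dr, c) \<in> lex_args" "set es \<subseteq> lex_args" "app_args c es \<in> cats"
    unfolding prods_unary_def by blast
  then show ?thesis using top_arg_tops[OF *(4,6)] unfolding *(1,2)
    by (auto simp: rhs_ok_mk_node intro!: rhs_ok_wrap) (auto simp: scg_simps)
qed

lemma finite_prods: "finite prods_start" "finite prods_lex" "finite prods_inner" "finite prods_unary"
proof -
  let ?S = "{z. set z \<subseteq> lex_args \<and> length z \<le> bound}"
  have dir: "finite (UNIV :: dir set)"
    by (rule finite_subset[of _ "{Fw, Bw}"]) (use dir.exhaust in auto)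
  have start: "prods_start \<subseteq> (\<lambda>c. (n0, Leaf (NT (nc c)))) ` cats" by (auto simp: prods_start_def)
  then show "finite prods_start" using finite_cats finite_surj by blast
  have lex: "prods_lex \<subseteq> (\<lambda>(a, z, vs). (nc (app_args (Atom a) z), wrap a (top_arg None z) vs (Leaf (T (tl (a, top_arg None (z @ vs))))))) `
    (targets \<times> ?S \<times> ?S)"
  proof
    fix p assume "p \<in> prods_lex"
    then obtain a z vs s where *: "p = (nc (app_args (Atom a) z), wrap a (top_arg None z) vs (Leaf (T (tl (a, top_arg None (z @ vs))))))"
      "(s, app_args (Atom a) (z @ vs)) \<in> lex G" unfolding prods_lex_def by blast
    with lex_cats[OF *(2)] show "p \<in> (\<lambda>(a, z, vs). (nc (app_args (Atom a) z), wrap a (top_arg None z) vs (Leaf (T (tl (a, top_arg None (z @ vs))))))) `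
      (targets \<times> ?S \<times> ?S)"
      unfolding cats_app_args by (intro image_eqI[of _ _ "(a, z, vs)"]) auto
  qed
  show "finite prods_lex" by (rule finite_surj[OF _ lex]) (use finite_targets finite_stacks in blast)
  have inner: "prods_inner \<subseteq> (\<lambda>(dr, a, x, c, es1, es2). (nc (app_args (Atom a) (x @ es1)), wrap a (top_arg None (x @ es1)) es2
     (mk_node dr (T (ti (a, top_arg None (x @ es1 @ es2)))) (Leaf (NT (nc (app_args (Atom a) (x @ [(slash_of dr, c)])))))
       (Leaf (NT (nc (app_args c (es1 @ es2)))))))) ` (UNIV \<times> targets \<times> ?S \<times> snd ` lex_args \<times> ?S \<times> ?S)" (is "_ \<subseteq> ?f ` ?X")
  proof
    fix p assume "p \<in> prods_inner"
    then obtain dr a x c es1 es2 where *: "p = ?f (dr, a, x, c, es1, es2)"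
      "a \<in> targets" "set x \<subseteq> lex_args" "(slash_of dr, c) \<in> lex_args"
      "set (es1 @ es2) \<subseteq> lex_args" "length (x @ es1) \<le> bound" "app_args c (es1 @ es2) \<in> cats"
      unfolding prods_inner_def prod.case by blast
    have "c \<in> snd ` lex_args" using *(4) by force
    then have "(dr, a, x, c, es1, es2) \<in> ?X" using * by (auto simp: cats_def)
    with *(1) show "p \<in> ?f ` ?X" by (rule image_eqI)
  qed
  show "finite prods_inner"
    by (rule finite_surj[OF _ inner]) (use dir finite_lex_args finite_targets finite_stacks in blast)
  have unary: "prods_unary \<subseteq> (\<lambda>(dr, a, l, c, es). (nu (a, l, (slash_of dr, c)), wrap a l es
     (mk_node dr (T (ti (a, top_arg l es))) (Leaf Hole) (Leaf (NT (nc (app_args c es))))))) `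
     (UNIV \<times> targets \<times> tops \<times> snd ` lex_args \<times> ?S)" (is "_ \<subseteq> ?f ` ?X")
  proof
    fix p assume "p \<in> prods_unary"
    then obtain dr a l c es where *: "p = ?f (dr, a, l, c, es)"
      "a \<in> targets" "l \<in> tops" "(slash_of dr, c) \<in> lex_args" "set es \<subseteq> lex_args" "app_args c es \<in> cats"
      unfolding prods_unary_def prod.case by blast
    have "c \<in> snd ` lex_args" using *(4) by force
    then have "(dr, a, l, c, es) \<in> ?X" using * by (auto simp: cats_def)
    with *(1) show "p \<in> ?f ` ?X" by (rule image_eqI)
  qed
  show "finite prods_unary"
    by (rule finite_surj[OF _ unary]) (use dir finite_lex_args finite_targets finite_stacks finite_tops in blast)
qed

lemma wf_scg: "wf_scftg scg"
  unfolding wf_scftg_def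
  using finite_cats finite_tops finite_targets finite_lex_args finite_prods disj
    prods_start_ok prods_lex_ok prods_inner_ok prods_unary_ok
  unfolding scg_simps by auto

section \<open>Soundness: generated trees come from derivations\<close>

fun image :: "'b cat rtree \<Rightarrow> nat rtree" where
  "image (Leaf c) = Leaf (tl (target c, last_arg c))"
| "image (Node1 c t) = image t"
| "image (Node2 c l r) = Node2 (ti (target c, last_arg c)) (image l) (image r)"

definition derives :: "'b cat \<Rightarrow> (nat, nat) sym rtree \<Rightarrow> bool" where
  "derives c t \<longleftrightarrow> (\<exists>d. ccg_deriv G d \<and> root d = c \<and> map_rtree T (image d) = t)"

lemma image_mk_node: "map_rtree T (image (mk_node dr c p q)) =
    mk_node dr (T (ti (target c, last_arg c))) (map_rtree T (image p)) (map_rtree T (image q))"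
  by (cases dr) auto

lemma derives_lex: "(s, app_args (Atom a) z) \<in> lex G \<Longrightarrow> derives (app_args (Atom a) z) (Leaf (T (tl (a, top_arg None z))))"
  unfolding derives_def
  by (intro exI[of _ "Leaf (app_args (Atom a) z)"]) (auto simp: last_arg_eq_top_arg intro: ccg_deriv.leaf)

lemma derives_step:
  assumes "inst dr a c es" "derives (app_args (Atom a) (x @ [(slash_of dr, c)])) t" "derives (app_args c es) u"
  shows "derives (app_args (Atom a) (x @ es)) (mk_node dr (T (ti (a, top_arg None (x @ es)))) t u)"
proof -
  from assms(1) obtain rl where rl: "rl \<in> rules G" "rule_inst rl dr a c es" by (auto simp: inst_def)
  from assms(2,3) obtain p q where
    p: "ccg_deriv G p" "root p = app_args (Atom a) (x @ [(slash_of dr, c)])" "map_rtree T (image p) = t"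
    and q: "ccg_deriv G q" "root q = app_args c es" "map_rtree T (image q) = u"
    unfolding derives_def by blast
  from ccg_deriv_step[OF p(1) q(1) rl p(2) q(2)] p(3) q(3) show ?thesis
    unfolding derives_def
    by (intro exI[of _ "mk_node dr (app_args (Atom a) (x @ es)) p q"])
      (simp add: image_mk_node last_arg_eq_top_arg del: app_args_append)
qed

lemma derives_holes: "derives c t \<Longrightarrow> holes t = 0"
  by (auto simp: derives_def)

text \<open>A segment never reads \<open>x\<close>, except that the last argument \<open>l\<close>
  of \<open>x\<close> shows in labels once the top arguments are gone. Hence one context
  \<open>C\<close> has to work for all \<open>x\<close> that end in \<open>l\<close>.\<close>

definition removes :: "'b \<Rightarrow> (slash \<times> 'b cat) option \<Rightarrow> (slash \<times> 'b cat) list \<Rightarrow> (nat, nat) sym rtree \<Rightarrow> bool" where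
  "removes a l vs C \<longleftrightarrow> (\<forall>x t. top_arg None x = l \<longrightarrow> derives (app_args (Atom a) (x @ vs)) t \<longrightarrow>
     derives (app_args (Atom a) x) (fill C t))"

text \<open>A logical relation, recursive in the form, that makes soundness a rule induction over
  \<open>ev\<close>. Nonterminals are bare numbers, so a clause demands the property for every
  object that the number may encode; the injectivity and disjointness assumptions leave at most
  one.\<close>

fun sem :: "(nat, nat) sym rtree \<Rightarrow> (nat, nat) sym rtree \<Rightarrow> bool" where
  "sem (Leaf (T s)) t = (t = Leaf (T s))"
| "sem (Leaf Hole) t = (t = Leaf Hole)"
| "sem (Leaf (NT n)) t = ((\<forall>c \<in> cats. n = nc c \<longrightarrow> derives c t) \<and>
     (n = n0 \<longrightarrow> (\<exists>a \<in> init G. derives (Atom a) t)))"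
| "sem (Node1 x s) t = (\<exists>C u. t = fill C u \<and> sem s u \<and>
     (\<forall>a \<in> targets. \<forall>l \<in> tops. \<forall>v \<in> lex_args. x = NT (nu (a, l, v)) \<longrightarrow> removes a l [v] C))"
| "sem (Node2 x l r) t = (\<exists>l' r'. t = Node2 x l' r' \<and> sem l l' \<and> sem r r')"

lemma sem_mk_node:
  "sem (mk_node dr x p q) t \<longleftrightarrow> (\<exists>p' q'. t = mk_node dr x p' q' \<and> sem p p' \<and> sem q q')"
  by (cases dr) auto

lemma sem_wrap:
  assumes "sem (wrap a l vs s) t" "a \<in> targets" "l \<in> tops" "set vs \<subseteq> lex_args"
  obtains C u where "t = fill C u" "sem s u" "removes a l vs C"
proof -
  have "\<exists>C u. t = fill C u \<and> sem s u \<and> removes a l vs C"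
    using assms
  proof (induction vs arbitrary: l t)
    case Nil
    then show ?case by (intro exI[of _ "Leaf Hole"] exI[of _ t]) (auto simp: removes_def)
  next
    case (Cons v vs)
    from Cons.prems obtain C u where C: "t = fill C u" "sem (wrap a (Some v) vs s) u" "removes a l [v] C"
      by auto
    have "Some v \<in> tops" using Cons.prems by (simp add: tops_def)
    with Cons.IH[OF C(2)] Cons.prems obtain D w where D: "u = fill D w" "sem s w" "removes a (Some v) vs D"
      by auto
    have "removes a l (v # vs) (fill C D)"
      unfolding removes_def
    proof (intro allI impI)
      fix x t assume x: "top_arg None x = l" "derives (app_args (Atom a) (x @ v # vs)) t"
      have "top_arg None (x @ [v]) = Some v" by (simp add: top_arg_def)
      with D(3) x(2) have "derives (app_args (Atom a) (x @ [v])) (fill D t)"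
        unfolding removes_def by (metis append.assoc append_Cons append_Nil)
      with C(3) x(1) show "derives (app_args (Atom a) x) (fill (fill C D) t)"
        unfolding removes_def by (simp add: fill_assoc[symmetric] del: app_args_append)
    qed
    with C D show ?case by (auto simp: fill_assoc)
  qed
  with that show thesis by blast
qed

lemma sem_nc: "sem (Leaf (NT (nc c))) t \<Longrightarrow> c \<in> cats \<Longrightarrow> derives c t"
  by simp

lemma nc_eq: "c \<in> cats \<Longrightarrow> c' \<in> cats \<Longrightarrow> nc c = nc c' \<Longrightarrow> c = c'"
  using inj_nc by (simp add: inj_on_eq_iff)

lemma ev_sem: "ev scg s t \<Longrightarrow> sem s t"
proof (induction rule: ev.induct)
  case (ev_NT0 n r t)
  from ev_NT0(1) consider "(n, r) \<in> prods_start" | "(n, r) \<in> prods_lex" | "(n, r) \<in> prods_inner"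
    by (auto simp: scg_simps)
  then show ?case
  proof cases
    case 1
    then obtain a where a: "n = n0" "r = Leaf (NT (nc (Atom a)))" "a \<in> init G" "Atom a \<in> cats"
      by (auto simp: prods_start_def)
    with ev_NT0(3) have "derives (Atom a) t" using sem_nc by blast
    with a disj show ?thesis by auto
  next
    case 2
    then obtain a z vs s where *: "n = nc (app_args (Atom a) z)"
      "r = wrap a (top_arg None z) vs (Leaf (T (tl (a, top_arg None (z @ vs)))))"
      "(s, app_args (Atom a) (z @ vs)) \<in> lex G" unfolding prods_lex_def by blast
    have c: "app_args (Atom a) (z @ vs) \<in> cats" using lex_cats[OF *(3)] .
    then have r: "a \<in> targets" "set z \<subseteq> lex_args" "set vs \<subseteq> lex_args" unfolding cats_app_args by auto
    from sem_wrap[OF ev_NT0(3)[unfolded *(2)] r(1) top_arg_tops[OF None_tops r(2)] r(3)] obtain C u where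
      "t = fill C u" "u = Leaf (T (tl (a, top_arg None (z @ vs))))" "removes a (top_arg None z) vs C" by auto
    then have "derives (app_args (Atom a) z) t"
      using derives_lex[OF *(3)] unfolding removes_def by blast
    then show ?thesis using nc_eq[OF cats_prefix[OF c]] cats_prefix[OF c] disj *(1) by auto
  next
    case 3
    then obtain dr a x c es1 es2 where *: "n = nc (app_args (Atom a) (x @ es1))"
      "r = wrap a (top_arg None (x @ es1)) es2
       (mk_node dr (T (ti (a, top_arg None (x @ es1 @ es2)))) (Leaf (NT (nc (app_args (Atom a) (x @ [(slash_of dr, c)])))))
         (Leaf (NT (nc (app_args c (es1 @ es2))))))"
      "es1 \<noteq> []" "a \<in> targets" "set x \<subseteq> lex_args" "(slash_of dr, c) \<in> lex_args"
       "set (es1 @ es2) \<subseteq> lex_args" "length (x @ es1) \<le> bound" "app_args c (es1 @ es2) \<in> cats"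
       "inst dr a c (es1 @ es2)"
      unfolding prods_inner_def by blast
      have "length (x @ [(slash_of dr, c)]) \<le> bound" using *(3,8) by (cases es1) auto
    then have c: "app_args (Atom a) (x @ [(slash_of dr, c)]) \<in> cats" "app_args (Atom a) (x @ es1) \<in> cats"
      unfolding cats_app_args using * by auto
    have t: "top_arg None (x @ es1) \<in> tops" "set es2 \<subseteq> lex_args"
      using * by (auto intro!: top_arg_tops None_tops)
    from sem_wrap[OF ev_NT0(3)[unfolded *(2)] *(4) t] obtain C p q where
      C: "t = fill C (mk_node dr (T (ti (a, top_arg None (x @ es1 @ es2)))) p q)" "removes a (top_arg None (x @ es1)) es2 C"
      and "sem (Leaf (NT (nc (app_args (Atom a) (x @ [(slash_of dr, c)]))))) p"
        "sem (Leaf (NT (nc (app_args c (es1 @ es2))))) q" unfolding sem_mk_node by metis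
    then have "derives (app_args (Atom a) (x @ [(slash_of dr, c)])) p" "derives (app_args c (es1 @ es2)) q"
      using sem_nc c(1) *(9) by blast+
    from derives_step[OF *(10) this] have "derives (app_args (Atom a) (x @ es1)) t"
      using C unfolding removes_def by (metis append.assoc)
    then show ?thesis using nc_eq[OF c(2)] c(2) disj *(1) by (auto simp del: app_args_append)
  qed
next
  case (ev_NT1 n C D s t)
  from ev_NT1(1) have "(n, C) \<in> prods_unary" by (simp add: scg_simps)
  then obtain dr a l c es where *: "n = nu (a, l, (slash_of dr, c))"
    "C = wrap a l es (mk_node dr (T (ti (a, top_arg l es))) (Leaf Hole) (Leaf (NT (nc (app_args c es)))))"
    "a \<in> targets" "l \<in> tops" "(slash_of dr, c) \<in> lex_args" "set es \<subseteq> lex_args" "app_args c es \<in> cats"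
    "inst dr a c es"
    unfolding prods_unary_def by blast
  from sem_wrap[OF ev_NT1(4)[unfolded *(2)] *(3,4,6)] obtain E q where
    E: "D = fill E (mk_node dr (T (ti (a, top_arg l es))) (Leaf Hole) q)" "removes a l es E"
    and "sem (Leaf (NT (nc (app_args c es)))) q" unfolding sem_mk_node by (metis sem.simps(2))
  then have q: "derives (app_args c es) q" using sem_nc *(7) by blast
  have "removes a l [(slash_of dr, c)] D"
    unfolding removes_def
  proof (intro allI impI)
    fix x t assume x: "top_arg None x = l" "derives (app_args (Atom a) (x @ [(slash_of dr, c)])) t"
    have "top_arg None (x @ es) = top_arg l es" using x(1) top_arg_append by metis
    with derives_step[OF *(8) x(2) q] E(2) x(1) have
      "derives (app_args (Atom a) x) (fill E (mk_node dr (T (ti (a, top_arg l es))) t q))"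
      unfolding removes_def by metis
    moreover have "fill (mk_node dr (T (ti (a, top_arg l es))) (Leaf Hole) q) t = mk_node dr (T (ti (a, top_arg l es))) t q"
      using derives_holes[OF q] by (cases dr) (auto simp: fill_no_hole)
    ultimately show "derives (app_args (Atom a) x) (fill D t)"
      by (simp add: E(1) fill_assoc[symmetric])
  qed
  moreover have "(a', l', v) = (a, l, (slash_of dr, c))"
    if "a' \<in> targets" "l' \<in> tops" "v \<in> lex_args" "nu (a', l', v) = n" for a' l' v
    using inj_onD[OF inj_nu, of "(a', l', v)" "(a, l, (slash_of dr, c))"] that * by simp
  ultimately show ?case using ev_NT1(5) unfolding sem.simps
    by (intro exI[of _ D] exI[of _ t]) auto
qed auto

section \<open>Completeness: derivations are generated\<close>

lemma ev_wrap: "ev scg (wrap a l vs (Leaf Hole)) C \<Longrightarrow> ev scg s t \<Longrightarrow> ev scg (wrap a l vs s) (fill C t)"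
  using ev_fill[OF wf_scg] wrap_fill by metis

lemma ev_mk_node: "ev scg p p' \<Longrightarrow> ev scg q q' \<Longrightarrow> ev scg (mk_node dr (T s) p q) (mk_node dr (T s) p' q')"
  by (cases dr) (auto intro: ev.intros)

lemma ev_wrap_appendE:
  assumes "ev scg (wrap a l (vs @ ws) (Leaf Hole)) C"
  obtains D E where "ev scg (wrap a l vs (Leaf Hole)) D" "ev scg (wrap a (top_arg l vs) ws (Leaf Hole)) E" "C = fill D E"
proof -
  have "ev scg (fill (wrap a l vs (Leaf Hole)) (wrap a (top_arg l vs) ws (Leaf Hole))) C"
    using assms unfolding wrap_append wrap_fill[of a l vs "wrap a (top_arg l vs) ws (Leaf Hole)"] .
  then show thesis by (rule ev_fillE[OF wf_scg, rotated]) (use that in auto)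
qed

text \<open>\<open>C\<close> acts as a continuation: it is the part of the spine, already generated,
  that removes \<open>v\<close> above \<open>d\<close>. Descending the spine moves nodes from
  \<open>d\<close> into \<open>C\<close> until a lexical category is met or the cut after
  \<open>z\<close> falls inside the arguments of a step.\<close>

lemma deriv_ev:
  assumes "ccg_deriv G d" "root d = app_args (Atom a) (z @ v)" "length z \<le> bound"
    "ev scg (wrap a (top_arg None z) v (Leaf Hole)) C"
  shows "ev scg (Leaf (NT (nc (app_args (Atom a) z)))) (fill C (map_rtree T (image d)))"
  using assms
proof (induction arbitrary: a z v C rule: ccg_deriv_stack_induct)
  case (lex s c)
  then have c: "c = app_args (Atom a) (z @ v)" by simp
  have "(nc (app_args (Atom a) z), wrap a (top_arg None z) v (Leaf (T (tl (a, top_arg None (z @ v)))))) \<in> P0 scg"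
    using lex(1) unfolding c scg_simps prods_lex_def by (auto simp del: app_args_append)
  from ev_NT0[OF this ev_wrap[OF lex.prems(3) ev_T]] show ?case
    unfolding c by (simp add: last_arg_eq_top_arg del: app_args_append)
next
  case (step p q rl dr b c es x)
  have eq: "b = a" "x @ es = z @ v" using step.prems(1) unfolding root_mk_node app_args_inject by auto
  have inst: "inst dr a c es" using step.hyps eq unfolding inst_def by blast
  note rp = deriv_range[OF step.hyps(1)]
  have r: "a \<in> targets" "set x \<subseteq> lex_args" "(slash_of dr, c) \<in> lex_args" using rp step.hyps(5) eq by auto
  have q: "app_args c es \<in> cats" using secondary_cats[OF inst r(3) step.hyps(2) step.hyps(6)] .
  then have es: "set es \<subseteq> lex_args" by (simp add: cats_def)
  define t :: "(nat, nat) sym rtree" where "t = map_rtree T (image p)"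
  define u :: "(nat, nat) sym rtree" where "u = map_rtree T (image q)"
  define m :: "(nat, nat) sym" where "m = T (ti (a, top_arg None (x @ es)))"
  have im: "map_rtree T (image (mk_node dr (app_args (Atom b) (x @ es)) p q)) = mk_node dr m t u"
    unfolding image_mk_node t_def u_def m_def eq(1) by (simp add: last_arg_eq_top_arg del: app_args_append)
  have "ev scg (Leaf (NT (nc (app_args (Atom (target c)) (cat_args c @ es))))) (fill (Leaf Hole) u)"
    unfolding u_def using q by (intro step.IH(2)[of _ _ "[]"]) (auto simp: cats_def step.hyps(6) intro: ev_Hole)
  then have evu: "ev scg (Leaf (NT (nc (app_args c es)))) u" by simp
  have hu: "holes u = 0" by (simp add: u_def)
  from eq(2) obtain ys where "x = z @ ys \<and> ys @ es = v \<or> x @ ys = z \<and> es = ys @ v"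
    unfolding append_eq_append_conv2 by blast
  \<comment> \<open>The cut between \<open>z\<close> and \<open>v\<close> lies inside
    \<open>x\<close> or inside \<open>es\<close>. If it falls exactly between them, the popped
    argument is the first one above \<open>z\<close> and a unary nonterminal can still remove it, so
    this belongs to the first case. The second case then has nonempty \<open>ys\<close>, as
    \<open>prods_inner\<close> requires.\<close>
  then consider ys where "x = z @ ys" "v = ys @ es" | ys where "z = x @ ys" "ys \<noteq> []" "es = ys @ v"
    by (cases "ys = []") auto
  then show ?case
  proof cases
    case 1
    from ev_wrap_appendE[OF step.prems(3)[unfolded 1(2)]] obtain D E where
      D: "ev scg (wrap a (top_arg None z) ys (Leaf Hole)) D" "ev scg (wrap a (top_arg None x) es (Leaf Hole)) E"
      "C = fill D E" by (auto simp: 1(1))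
    have "(nu (a, top_arg None x, (slash_of dr, c)), wrap a (top_arg None x) es
       (mk_node dr (T (ti (a, top_arg (top_arg None x) es))) (Leaf Hole) (Leaf (NT (nc (app_args c es)))))) \<in> P1 scg"
      unfolding scg_simps prods_unary_def using inst r es q top_arg_tops[OF None_tops r(2)] by blast
    then have "(nu (a, top_arg None x, (slash_of dr, c)), wrap a (top_arg None x) es
       (mk_node dr m (Leaf Hole) (Leaf (NT (nc (app_args c es)))))) \<in> P1 scg"
      unfolding m_def top_arg_append .
    from ev_NT1[OF this ev_wrap[OF D(2)] ev_Hole] ev_mk_node[OF ev_Hole evu] have
      "ev scg (Node1 (NT (nu (a, top_arg None x, (slash_of dr, c)))) (Leaf Hole)) (fill E (mk_node dr m (Leaf Hole) u))"
      unfolding m_def by force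
    from ev_wrap[OF D(1) this] have "ev scg (wrap a (top_arg None z) (ys @ [(slash_of dr, c)]) (Leaf Hole))
        (fill D (fill E (mk_node dr m (Leaf Hole) u)))"
      unfolding wrap_append by (simp add: 1(1))
    from step.IH(1)[OF _ step.prems(2) this] step.hyps(5) eq(1) 1(1) have
      "ev scg (Leaf (NT (nc (app_args (Atom a) z)))) (fill (fill D (fill E (mk_node dr m (Leaf Hole) u))) t)"
      unfolding t_def by simp
    moreover have "fill (mk_node dr m (Leaf Hole) u) t = mk_node dr m t u"
      using hu by (cases dr) (auto simp: fill_no_hole)
    ultimately show ?thesis unfolding im D(3) by (simp add: fill_assoc[symmetric])
  next
    case 2
    have len: "length (x @ ys) \<le> bound" "Suc (length x) \<le> bound"
      using step.prems(2) 2(1,2) by (cases ys; simp)+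
    have "(nc (app_args (Atom a) (x @ ys)), wrap a (top_arg None (x @ ys)) v
       (mk_node dr m (Leaf (NT (nc (app_args (Atom a) (x @ [(slash_of dr, c)])))))
         (Leaf (NT (nc (app_args c es)))))) \<in> prods_inner"
      unfolding prods_inner_def m_def 2(3) using inst r es q len 2 by blast
    then have P: "(nc (app_args (Atom a) z), wrap a (top_arg None z) v
       (mk_node dr m (Leaf (NT (nc (app_args (Atom a) (x @ [(slash_of dr, c)])))))
         (Leaf (NT (nc (app_args c es)))))) \<in> P0 scg" unfolding scg_simps 2(1) by simp
    have "ev scg (Leaf (NT (nc (app_args (Atom a) (x @ [(slash_of dr, c)]))))) (fill (Leaf Hole) t)"
      unfolding t_def using len step.hyps(5) eq(1)
      by (intro step.IH(1)[of _ _ "[]"]) (auto intro: ev_Hole)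
    then have "ev scg (Leaf (NT (nc (app_args (Atom a) (x @ [(slash_of dr, c)]))))) t" by simp
    from ev_NT0[OF P ev_wrap[OF step.prems(3)]] ev_mk_node[OF this evu] show ?thesis
      unfolding im m_def by force
  qed
qed

lemma scg_lang:
  "t \<in> scftg_lang scg \<longleftrightarrow> (\<exists>d. ccg_deriv G d \<and> (\<exists>a \<in> init G. root d = Atom a) \<and> image d = t)"
proof
  have inj: "map_rtree T s = map_rtree T t \<longleftrightarrow> s = t" for s t :: "nat rtree"
    using rtree.inj_map[of T] by (auto simp: inj_def)
  note st = scg_simps(5)
  {
    assume "t \<in> scftg_lang scg"
    then have "ev scg (Leaf (NT n0)) (map_rtree T t)" by (simp add: scftg_lang_iff_ev[OF wf_scg] st)
    from ev_sem[OF this] show "\<exists>d. ccg_deriv G d \<and> (\<exists>a \<in> init G. root d = Atom a) \<and> image d = t"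
      by (auto simp: derives_def inj)
  next
    assume "\<exists>d. ccg_deriv G d \<and> (\<exists>a \<in> init G. root d = Atom a) \<and> image d = t"
    then obtain d a where d: "ccg_deriv G d" "a \<in> init G" "root d = Atom a" "image d = t" by blast
    have "Atom a \<in> cats" using deriv_range[OF d(1)] d(3) by (simp add: cats_def)
    then have P: "(n0, Leaf (NT (nc (Atom a)))) \<in> P0 scg"
      using d(2) unfolding scg_simps prods_start_def by blast
    have "ev scg (Leaf (NT (nc (app_args (Atom a) [])))) (fill (Leaf Hole) (map_rtree T (image d)))"
      by (rule deriv_ev[OF d(1), of a "[]" "[]"]) (auto simp: d(3) intro: ev_Hole)
    with ev_NT0[OF P] d(4) have "ev scg (Leaf (NT n0)) (map_rtree T t)" by simp
    moreover have "no_unary (image d)" using ccg_deriv_no_unary[OF d(1)] by (induction d) auto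
    ultimately show "t \<in> scftg_lang scg" using d(4) by (simp add: scftg_lang_iff_ev[OF wf_scg] st)
  }
qed

end

section \<open>Encoding by natural numbers and the resulting relabeling\<close>

lemma ccg_to_scftg:
  fixes G :: "('a, 'b) ccg" and \<rho> :: "'b cat \<Rightarrow> 'c"
  assumes wf: "wf_ccg G" and \<rho>: "cat_relabeling \<rho>"
  shows "\<exists>(G' :: (nat, nat) scftg) (\<pi> :: nat \<Rightarrow> 'c).
    wf_scftg G' \<and> map_rtree \<pi> ` scftg_lang G' = ccg_lang G \<rho>"
proof -
  interpret ccg G by standard (rule wf)
  obtain ec :: "'b cat \<Rightarrow> nat" where ec: "inj_on ec cats"
    using finite_imp_inj_to_nat_seg[OF finite_cats] by blast
  obtain eu :: "'b \<times> (slash \<times> 'b cat) option \<times> (slash \<times> 'b cat) \<Rightarrow> nat"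
    where eu: "inj_on eu (targets \<times> tops \<times> lex_args)"
    using finite_imp_inj_to_nat_seg[of "targets \<times> tops \<times> lex_args"] finite_targets finite_tops finite_lex_args by auto
  obtain ek :: "'b \<times> (slash \<times> 'b cat) option \<Rightarrow> nat" where ek: "inj_on ek (targets \<times> tops)"
    using finite_imp_inj_to_nat_seg[of "targets \<times> tops"] finite_targets finite_tops by auto
  \<comment> \<open>Disjoint codes: 0 is the start symbol, positive even numbers are the other
    nullary nonterminals, odd numbers the unary ones. Among the terminals, even means leaf and odd
    means inner node.\<close>
  interpret ccg_scftg G "\<lambda>c. Suc (Suc (2 * ec c))" "\<lambda>u. Suc (2 * eu u)" "\<lambda>k. 2 * ek k" "\<lambda>k. Suc (2 * ek k)" 0
  proof
    show "inj_on (\<lambda>c. Suc (Suc (2 * ec c))) cats" using ec by (simp add: inj_on_def)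
    show "inj_on (\<lambda>u. Suc (2 * eu u)) (targets \<times> tops \<times> lex_args)" using eu unfolding inj_on_def by simp
  qed (auto, presburger+)
  \<comment> \<open>Halving recovers the key from both kinds of terminals. Any category with that
    target and last argument will do, because \<rho> takes the same value on all of them.\<close>
  define \<pi> where "\<pi> n = \<rho> (SOME c. (target c, last_arg c) = inv_into (targets \<times> tops) ek (n div 2))" for n :: nat
  have \<pi>: "\<pi> (2 * ek (target c, last_arg c)) = \<rho> c" "\<pi> (Suc (2 * ek (target c, last_arg c))) = \<rho> c"
    if "target c \<in> targets" "last_arg c \<in> tops" for c
  proof -
    let ?k = "(target c, last_arg c)"
    have "(target (SOME c'. (target c', last_arg c') = ?k), last_arg (SOME c'. (target c', last_arg c') = ?k)) = ?k"
      by (rule someI[of "\<lambda>c'. (target c', last_arg c') = ?k" c]) simp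
    then have "\<rho> (SOME c'. (target c', last_arg c') = ?k) = \<rho> c"
      using \<rho> unfolding cat_relabeling_def by blast
    then show "\<pi> (2 * ek ?k) = \<rho> c" "\<pi> (Suc (2 * ek ?k)) = \<rho> c"
      using that by (simp_all add: \<pi>_def inv_into_f_f[OF ek])
  qed
  have r: "target (root d) \<in> targets \<and> last_arg (root d) \<in> tops" if "ccg_deriv G d" for d
  proof -
    have "last_arg (app_args (Atom (target (root d))) (cat_args (root d))) \<in> tops"
      unfolding last_arg_eq_top_arg using deriv_range[OF that] by (intro top_arg_tops None_tops) auto
    with deriv_range[OF that] show ?thesis by simp
  qed
  have im: "map_rtree \<pi> (image d) = map_rtree \<rho> d" if "ccg_deriv G d" for d
    using that
  proof (induction rule: ccg_deriv.induct)
    case (leaf s c)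
    with r[OF ccg_deriv.leaf[OF leaf]] \<pi>[of c] show ?case by simp
  next
    case (bin p q rl c)
    with r[OF ccg_deriv.bin[OF bin(1,2,3,4)]] \<pi>[of c] show ?case by simp
  qed
  have "map_rtree \<pi> ` scftg_lang scg = ccg_lang G \<rho>"
  proof (intro equalityI subsetI)
    fix t assume "t \<in> map_rtree \<pi> ` scftg_lang scg"
    then show "t \<in> ccg_lang G \<rho>" unfolding ccg_lang_def using im by (auto simp: scg_lang) metis
  next
    fix t assume "t \<in> ccg_lang G \<rho>"
    then obtain d a where d: "t = map_rtree \<rho> d" "ccg_deriv G d" "a \<in> init G" "root d = Atom a"
      unfolding ccg_lang_def by blast
    then have "image d \<in> scftg_lang scg" unfolding scg_lang by blast
    with im[OF d(2)] d(1) show "t \<in> map_rtree \<pi> ` scftg_lang scg" by (metis image_eqI)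
  qed
  with wf_scg show ?thesis by blast
qed

section \<open>From sCFTGs to CCGs\<close>

type_synonym ('t, 'n) form = "('t, 'n) sym rtree"

fun subforms :: "'x rtree \<Rightarrow> 'x rtree set" where
  "subforms (Leaf x) = {Leaf x}"
| "subforms (Node1 x s) = insert (Node1 x s) (subforms s)"
| "subforms (Node2 x l r) = insert (Node2 x l r) (subforms l \<union> subforms r)"

lemma subforms_refl [simp]: "s \<in> subforms s"
  by (cases s) auto

lemma finite_subforms: "finite (subforms s)"
  by (induction s) auto

lemma subforms_trans: "s \<in> subforms t \<Longrightarrow> t \<in> subforms u \<Longrightarrow> s \<in> subforms u"
  by (induction u) auto

text \<open>Besides the subforms of right-hand sides, the calls of a unary nonterminal on a bare
  hole are included: they are the goals of the stack symbols that finish an entered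
  production.\<close>

definition items :: "('t, 'n) scftg \<Rightarrow> ('t, 'n) form set" where
  "items G = (\<Union>s \<in> insert (Leaf (NT (start G))) (snd ` P0 G \<union> snd ` P1 G \<union>
     (\<lambda>n. Node1 (NT n) (Leaf Hole)) ` N1 G). subforms s)"

definition labels :: "('t, 'n) scftg \<Rightarrow> ('t, 'n) sym set" where
  "labels G = T ` (Sig0 G \<union> Sig2 G)"

text \<open>A stack symbol \<open>(g, X, \<sigma>, \<sigma>')\<close> stands for the rest of a spine, read upwards, from a
  tree with root label \<open>\<sigma>\<close> generated by the form \<open>X\<close> to a tree with root label \<open>\<sigma>'\<close>
  generated by the form \<open>g\<close>.\<close>
type_synonym ('t, 'n) ssym = "('t, 'n) form \<times> ('t, 'n) form \<times> ('t, 'n) sym \<times> ('t, 'n) sym"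

definition ssyms :: "('t, 'n) scftg \<Rightarrow> ('t, 'n) ssym set" where
  "ssyms G = items G \<times> items G \<times> labels G \<times> labels G"

definition top_label :: "('t, 'n) ssym \<Rightarrow> ('t, 'n) sym" where
  "top_label s = fst (snd (snd s))"

definition out_label :: "('t, 'n) ssym \<Rightarrow> ('t, 'n) sym" where
  "out_label s = snd (snd (snd s))"

text \<open>The atom \<open>(i, s, B, \<tau>)\<close>, used as an argument, is the stack symbol \<open>s\<close> whose next step
  attaches a side tree generated by \<open>B\<close> with root label \<open>\<tau>\<close>; used as a target, it marks the
  spine of that side tree. The colour \<open>i\<close> separates, in a category with target \<open>c\<close>, the
  arguments that belong to the spine of \<open>c\<close> (other colour) from those that the secondary
  category has to hand over to the primary spine (same colour).\<close>
type_synonym ('t, 'n) datom = "bool \<times> ('t, 'n) ssym \<times> ('t, 'n) form \<times> ('t, 'n) sym"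

definition datoms :: "('t, 'n) scftg \<Rightarrow> ('t, 'n) datom set" where
  "datoms G = UNIV \<times> ssyms G \<times> items G \<times> labels G"

text \<open>Invariant of a spine read upwards. The current tree is a part \<open>C\<close> generated
  by \<open>X\<close> on top of an older part \<open>u\<close>; working off the top symbol turns
  \<open>C\<close> into something generated by \<open>g\<close> and leaves \<open>u\<close> alone.
  Quantifying over all such \<open>C'\<close> keeps the invariant independent of how the symbol is
  worked off.\<close>

fun good :: "('t, 'n) scftg \<Rightarrow> ('t, 'n) form \<Rightarrow> ('t, 'n) ssym list \<Rightarrow> ('t, 'n) form \<Rightarrow> bool" where
  "good G q [] t = ev G q t"
| "good G q ((g, X, _, _) # st) t =
     (\<exists>C u. t = fill C u \<and> ev G X C \<and> (\<forall>C'. ev G g C' \<longrightarrow> good G q st (fill C' u)))"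

fun chain :: "('t, 'n) sym \<Rightarrow> ('t, 'n) ssym list \<Rightarrow> ('t, 'n) sym \<Rightarrow> bool" where
  "chain \<sigma> [] \<sigma>' = (\<sigma> = \<sigma>')"
| "chain \<sigma> (s # st) \<sigma>' = (top_label s = \<sigma> \<and> chain (out_label s) st \<sigma>')"

text \<open>Steps of the pushdown process are admitted by a semantic criterion; this saves the
  elimination of \<open>\<epsilon>\<close>-productions, chain productions and left recursion.\<close>
definition valid_step :: "('t, 'n) scftg \<Rightarrow> ('t, 'n) ssym \<Rightarrow> dir \<Rightarrow> ('t, 'n) form \<Rightarrow>
    ('t, 'n) ssym list \<Rightarrow> ('t, 'n) sym \<Rightarrow> bool" where
  "valid_step G s dr B st \<sigma> \<longleftrightarrow> (case s of (g, X, _, \<sigma>') \<Rightarrow>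
     s \<in> ssyms G \<and> B \<in> items G \<and> holes B = 0 \<and> set st \<subseteq> ssyms G \<and> length st \<le> 2 \<and> chain \<sigma> st \<sigma>' \<and>
     (\<forall>C t. ev G X C \<longrightarrow> ev G B t \<longrightarrow> good G g st (mk_node dr \<sigma> C t)))"

text \<open>Complete runs of the process: \<open>K\<close> is the context laid above the current
  tree while a symbol or a stack is worked off, and \<open>full\<close> starts such a run at a leaf.
  Side trees have spines of their own, hence the mutual recursion.\<close>

inductive up :: "('t, 'n) scftg \<Rightarrow> ('t, 'n) ssym \<Rightarrow> ('t, 'n) form \<Rightarrow> bool"
  and ups :: "('t, 'n) scftg \<Rightarrow> ('t, 'n) ssym list \<Rightarrow> ('t, 'n) form \<Rightarrow> bool"
  and full :: "('t, 'n) scftg \<Rightarrow> ('t, 'n) form \<Rightarrow> ('t, 'n) form \<Rightarrow> ('t, 'n) sym \<Rightarrow> bool"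
  for G where
  up_step: "valid_step G s dr B st \<sigma> \<Longrightarrow> full G B t \<tau> \<Longrightarrow> \<tau> \<in> labels G \<Longrightarrow> ups G st K \<Longrightarrow>
    up G s (fill K (mk_node dr \<sigma> (Leaf Hole) t))"
| ups_Nil: "ups G [] (Leaf Hole)"
| ups_Cons: "up G s K \<Longrightarrow> ups G st K' \<Longrightarrow> ups G (s # st) (fill K' K)"
| full_leaf: "ev G B (Leaf (T a)) \<Longrightarrow> full G B (Leaf (T a)) (T a)"
| full_up: "up G (B, Leaf (T a), T a, \<tau>) K \<Longrightarrow> full G B (fill K (Leaf (T a))) \<tau>"

inductive_cases upE: "up G s K"

lemma fill_mk_node: "holes t = 0 \<Longrightarrow> fill (mk_node dr \<sigma> C t) u = mk_node dr \<sigma> (fill C u) t"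
  by (cases dr) (auto simp: fill_no_hole)

text \<open>While \<open>st\<close> is worked off above \<open>D\<close>, the tree \<open>u\<close>
  just hangs in its hole; afterwards \<open>D\<close> has become something generated by
  \<open>g\<close>, which is where \<open>st'\<close> takes over.\<close>

lemma good_append:
  assumes "good G g st D" "\<And>C'. ev G g C' \<Longrightarrow> good G q st' (fill C' u)"
  shows "good G q (st @ st') (fill D u)"
  using assms(1)
proof (induction st arbitrary: D)
  case (Cons s st)
  obtain g1 X1 a b where s: "s = (g1, X1, a, b)" by (cases s)
  from Cons.prems obtain C v where C: "D = fill C v" "ev G X1 C"
    "\<And>C'. ev G g1 C' \<Longrightarrow> good G g st (fill C' v)" by (auto simp: s)
  have "fill D u = fill C (fill v u)" using C(1) by (simp add: fill_assoc)
  moreover have "good G q (st @ st') (fill C' (fill v u))" if "ev G g1 C'" for C'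
    using Cons.IH[OF C(3)[OF that]] by (simp add: fill_assoc)
  ultimately show ?case using C(2) by (auto simp: s)
qed (use assms(2) in auto)

lemma chain_append: "chain \<sigma> st \<sigma>' \<Longrightarrow> chain \<sigma>' st' \<sigma>'' \<Longrightarrow> chain \<sigma> (st @ st') \<sigma>''"
  by (induction st arbitrary: \<sigma>) auto

lemma ups_append: "ups G st K \<Longrightarrow> ups G st' K' \<Longrightarrow> ups G (st @ st') (fill K' K)"
proof (induction st arbitrary: K)
  case Nil
  then show ?case by (auto elim: ups.cases)
next
  case (Cons s st)
  from Cons.prems(1) obtain K1 K2 where "up G s K1" "ups G st K2" "K = fill K2 K1"
    by (auto elim: ups.cases)
  with Cons.IH[OF this(2) Cons.prems(2)] show ?case
    by (auto simp: fill_assoc intro: up_ups_full.intros)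
qed

section \<open>Every generated tree arises from the pushdown process\<close>

locale scftg =
  fixes G :: "('t, 'n) scftg"
  assumes wf: "wf_scftg G"
begin

lemma finite_items: "finite (items G)"
  using wf unfolding items_def wf_scftg_def by (auto simp: finite_subforms)

lemma finite_labels: "finite (labels G)"
  using wf unfolding labels_def wf_scftg_def by auto

lemma finite_datoms: "finite (datoms G)"
  unfolding datoms_def ssyms_def by (simp add: finite_items finite_labels)

lemma items_Node1: "Node1 x s \<in> items G \<Longrightarrow> s \<in> items G"
  unfolding items_def using subforms_trans[of s "Node1 x s"] by fastforce

lemma items_Node2: "Node2 x l r \<in> items G \<Longrightarrow> l \<in> items G \<and> r \<in> items G"
  unfolding items_def using subforms_trans[of l "Node2 x l r"] subforms_trans[of r "Node2 x l r"]
  by fastforce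

lemma items_P0: "(n, r) \<in> P0 G \<Longrightarrow> r \<in> items G"
  unfolding items_def by force

lemma items_P1: "(n, C) \<in> P1 G \<Longrightarrow> C \<in> items G"
  unfolding items_def by force

lemma items_N1: "n \<in> N1 G \<Longrightarrow> Node1 (NT n) (Leaf Hole) \<in> items G"
  unfolding items_def by force

lemma items_start: "Leaf (NT (start G)) \<in> items G"
  unfolding items_def by force

lemma rhs_ok_subforms: "rhs_ok G t \<Longrightarrow> s \<in> subforms t \<Longrightarrow> rhs_ok G s"
proof (induction t)
  case (Node1 x t)
  then show ?case by (cases x) auto
next
  case (Node2 x l r)
  then show ?case by (cases x) auto
qed auto

lemma items_rhs_ok: "s \<in> items G \<Longrightarrow> rhs_ok G s"
  using wf unfolding items_def wf_scftg_def by (auto intro: rhs_ok_subforms)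

lemma ev_root_label: "ev G s t \<Longrightarrow> rhs_ok G s \<Longrightarrow> t \<noteq> Leaf Hole \<Longrightarrow> root t \<in> labels G"
proof (induction rule: ev.induct)
  case (ev_NT1 n C D s t)
  show ?case
  proof (cases "D = Leaf Hole")
    case True
    with ev_NT1 show ?thesis by simp
  next
    case False
    with ev_NT1 wf_P1[OF wf ev_NT1(1)] show ?thesis by (simp add: root_fill)
  qed
next
  case (ev_NT0 n r t)
  with wf_P0[OF wf ev_NT0(1)] show ?case by simp
qed (auto simp: labels_def)

definition le :: "('t, 'n) form \<Rightarrow> ('t, 'n) form \<Rightarrow> bool" where
  "le X Y \<longleftrightarrow> (\<forall>t. ev G X t \<longrightarrow> ev G Y t)"

text \<open>With \<open>le\<close> instead of equality, passing from \<open>X\<close> to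
  \<open>g\<close> without adding a node costs no stack symbol. This is where chain productions and
  erasing productions disappear.\<close>

definition ustar :: "('t, 'n) form \<Rightarrow> ('t, 'n) form \<Rightarrow> ('t, 'n) sym \<Rightarrow> ('t, 'n) form \<Rightarrow> ('t, 'n) sym \<Rightarrow> bool" where
  "ustar g X \<sigma> K \<sigma>' \<longleftrightarrow> K = Leaf Hole \<and> le X g \<and> \<sigma> = \<sigma>' \<or> up G (g, X, \<sigma>, \<sigma>') K"

lemma up_ssyms: "up G s K \<Longrightarrow> s \<in> ssyms G"
  by (auto elim!: upE simp: valid_step_def)

lemma ustar_ups:
  assumes "ustar g X \<sigma> K \<sigma>'"
  obtains st where "ups G st K" "set st \<subseteq> ssyms G" "length st \<le> 1" "chain \<sigma> st \<sigma>'"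
    "\<And>t. ev G X t \<Longrightarrow> good G g st t"
proof (cases "up G (g, X, \<sigma>, \<sigma>') K")
  case True
  have "ups G [(g, X, \<sigma>, \<sigma>')] K" using ups_Cons[OF True ups_Nil] by simp
  moreover have "good G g [(g, X, \<sigma>, \<sigma>')] t" if "ev G X t" for t
    using that by simp (metis fill_Hole)
  ultimately show thesis
    using True that[of "[(g, X, \<sigma>, \<sigma>')]"] by (simp add: up_ssyms top_label_def out_label_def)
next
  case False
  with assms have "K = Leaf Hole" "le X g" "\<sigma> = \<sigma>'" by (auto simp: ustar_def)
  with that[of "[]"] show thesis by (auto simp: le_def intro: up_ups_full.intros)
qed

text \<open>\<open>valid_step\<close> uses \<open>X\<close> only through the trees it generates, and
  it is antitone in them: every first step available from \<open>X'\<close> is available from a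
  smaller \<open>X\<close>.\<close>

lemma ustar_mono:
  assumes "le X X'" "X \<in> items G" "ustar g X' \<sigma> K \<sigma>'"
  shows "ustar g X \<sigma> K \<sigma>'"
proof (cases "up G (g, X', \<sigma>, \<sigma>') K")
  case True
  then obtain dr B st \<sigma>1 t \<tau> K' where *: "valid_step G (g, X', \<sigma>, \<sigma>') dr B st \<sigma>1"
    "full G B t \<tau>" "\<tau> \<in> labels G" "ups G st K'" "K = fill K' (mk_node dr \<sigma>1 (Leaf Hole) t)"
    by (auto elim: upE)
  have "valid_step G (g, X, \<sigma>, \<sigma>') dr B st \<sigma>1"
    using *(1) assms(1,2) by (auto simp: valid_step_def le_def ssyms_def)
  with * show ?thesis by (auto simp: ustar_def intro: up_step)
qed (use assms in \<open>auto simp: ustar_def le_def\<close>)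

lemma up_edge:
  assumes "\<And>C t. ev G X C \<Longrightarrow> ev G B t \<Longrightarrow> ev G X1 (mk_node dr \<sigma>1 C t)"
    and B: "B \<in> items G" "holes B = 0" "full G B t1 \<tau>" "\<tau> \<in> labels G"
    and "ustar g X1 \<sigma>1 K \<sigma>'" "(g, X, \<sigma>, \<sigma>') \<in> ssyms G"
  shows "up G (g, X, \<sigma>, \<sigma>') (fill K (mk_node dr \<sigma>1 (Leaf Hole) t1))"
proof -
  from ustar_ups[OF assms(6)] obtain st where st: "ups G st K" "set st \<subseteq> ssyms G" "length st \<le> 1"
    "chain \<sigma>1 st \<sigma>'" "\<And>t. ev G X1 t \<Longrightarrow> good G g st t" by blast
  then have "valid_step G (g, X, \<sigma>, \<sigma>') dr B st \<sigma>1"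
    using assms by (auto simp: valid_step_def)
  from up_step[OF this B(3,4) st(1)] show ?thesis .
qed

text \<open>A left corner: the node directly above the hole with its side tree, followed by the
  remainder \<open>K\<close> up to the goal \<open>g\<close>. The lowest node is kept apart because
  it becomes the first step of the symbol that enters this context.\<close>

definition first_up :: "('t, 'n) form \<Rightarrow> ('t, 'n) sym \<Rightarrow> ('t, 'n) form \<Rightarrow> bool" where
  "first_up g \<sigma>' D \<longleftrightarrow> (\<exists>dr B \<sigma>1 t1 \<tau> X1 K. B \<in> items G \<and> holes B = 0 \<and> full G B t1 \<tau> \<and> \<tau> \<in> labels G \<and>
     (\<forall>t. ev G B t \<longrightarrow> ev G X1 (mk_node dr \<sigma>1 (Leaf Hole) t)) \<and>
     D = fill K (mk_node dr \<sigma>1 (Leaf Hole) t1) \<and> ustar g X1 \<sigma>1 K \<sigma>')"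

lemma ev_Node1_Hole:
  assumes "ev G (Node1 (NT n) (Leaf Hole)) C" "ev G s t"
  shows "ev G (Node1 (NT n) s) (fill C t)"
  using assms by (auto elim!: ev_Node1E ev_HoleE intro: ev_NT1)

text \<open>The origin of the length bound two. After the left-corner node, \<open>st\<close>
  finishes the called context and \<open>st'\<close> continues in the caller; each has at most one
  symbol by \<open>ustar_ups\<close>.\<close>

lemma up_call:
  assumes "first_up (Node1 (NT n) (Leaf Hole)) \<sigma>m D" "ustar g (Node1 (NT n) X) \<sigma>m K \<sigma>'"
    "(g, X, \<sigma>, \<sigma>') \<in> ssyms G"
  shows "up G (g, X, \<sigma>, \<sigma>') (fill K D)"
proof -
  let ?n = "Node1 (NT n) (Leaf Hole)"
  from assms(1) obtain dr B \<sigma>1 t1 \<tau> X1 K1 where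
    B: "B \<in> items G" "holes B = 0" "full G B t1 \<tau>" "\<tau> \<in> labels G"
    and X1: "\<And>t. ev G B t \<Longrightarrow> ev G X1 (mk_node dr \<sigma>1 (Leaf Hole) t)"
    and D: "D = fill K1 (mk_node dr \<sigma>1 (Leaf Hole) t1)" "ustar ?n X1 \<sigma>1 K1 \<sigma>m"
    unfolding first_up_def by blast
  from ustar_ups[OF D(2)] obtain st where st: "ups G st K1" "set st \<subseteq> ssyms G" "length st \<le> 1"
    "chain \<sigma>1 st \<sigma>m" "\<And>t. ev G X1 t \<Longrightarrow> good G ?n st t" by blast
  from ustar_ups[OF assms(2)] obtain st' where st': "ups G st' K" "set st' \<subseteq> ssyms G" "length st' \<le> 1"
    "chain \<sigma>m st' \<sigma>'" "\<And>t. ev G (Node1 (NT n) X) t \<Longrightarrow> good G g st' t" by blast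
  have "good G g (st @ st') (mk_node dr \<sigma>1 C t)" if C: "ev G X C" and t: "ev G B t" for C t
  proof -
    have "holes t = 0" using ev_holes[OF wf t] B by simp
    then have "mk_node dr \<sigma>1 C t = fill (mk_node dr \<sigma>1 (Leaf Hole) t) C"
      by (simp add: fill_mk_node)
    with good_append[OF st(5)[OF X1[OF t]], of g st' C] st'(5) ev_Node1_Hole[OF _ C]
    show ?thesis by simp
  qed
  then have "valid_step G (g, X, \<sigma>, \<sigma>') dr B (st @ st') \<sigma>1"
    using st st' B assms(3) by (auto simp: valid_step_def intro: chain_append)
  from up_step[OF this B(3,4) ups_append[OF st(1) st'(1)]] show ?thesis
    by (simp add: D(1) fill_assoc)
qed

lemma le_NT0: "(n, r) \<in> P0 G \<Longrightarrow> le r (Leaf (NT n))"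
  by (auto simp: le_def intro: ev_NT0)

text \<open>Greibach normal form in one induction. A spine is extended downwards, from its remainder \<open>K\<close>
  above \<open>X\<close>, and whenever \<open>X\<close> starts at the hole of a production, that production is entered
  through its left corner, so that the first step never needs a call.\<close>
lemma ev_spine:
  assumes "ev G X t" "X \<in> items G"
  shows "(holes X = 0 \<longrightarrow> (\<forall>g K \<sigma>'. g \<in> items G \<longrightarrow> \<sigma>' \<in> labels G \<longrightarrow> ustar g X (root t) K \<sigma>' \<longrightarrow>
            full G g (fill K t) \<sigma>')) \<and>
         (holes X = 1 \<longrightarrow> (\<forall>g K \<sigma>'. g \<in> items G \<longrightarrow> \<sigma>' \<in> labels G \<longrightarrow> ustar g X (root t) K \<sigma>' \<longrightarrow>
            t = Leaf Hole \<or> first_up g \<sigma>' (fill K t)))"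
  using assms
proof (induction)
  case (ev_T s)
  show ?case
    by (auto simp: ustar_def le_def intro: up_ups_full.intros ev.intros)
next
  case ev_Hole
  then show ?case by simp
next
  case (ev_NT0 n r t)
  have "holes r = 0" "r \<in> items G" using wf_P0[OF wf ev_NT0(1)] items_P0[OF ev_NT0(1)] by auto
  with ev_NT0 ustar_mono[OF le_NT0[OF ev_NT0(1)]] show ?case by auto
next
  case (ev_NT1 n C D s t)
  let ?X = "Node1 (NT n) s" and ?n = "Node1 (NT n) (Leaf Hole)"
  have s: "s \<in> items G" using items_Node1 ev_NT1.prems by blast
  have C: "C \<in> items G" "holes C = 1" "n \<in> N1 G"
    using wf_P1[OF wf ev_NT1(1)] items_P1[OF ev_NT1(1)] by auto
  have X: "holes ?X = holes s" by simp
  note IHC = ev_NT1.IH(1)[OF C(1), THEN conjunct2, rule_format, OF C(2)]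
  note IHs = ev_NT1.IH(2)[OF s]
  have ht: "holes t = holes s" using ev_holes[OF wf ev_NT1.hyps(3)] .
  \<comment> \<open>A remainder \<open>K\<close> above the call becomes the remainder
    \<open>fill K D\<close> above its argument. If the production erases itself, this is a mere
    inclusion of forms; otherwise the body is entered at its left corner, which the induction
    hypothesis supplies for the empty remainder above \<open>C\<close>.\<close>
  have reduce: "ustar g s (root t) (fill K D) \<sigma>'"
    if u: "ustar g ?X (root (fill D t)) K \<sigma>'" and g: "g \<in> items G" "\<sigma>' \<in> labels G"
      and t: "t \<noteq> Leaf Hole" for g K \<sigma>'
  proof (cases "D = Leaf Hole")
    case True
    have "le s ?X" using ev.ev_NT1[OF ev_NT1.hyps(1,2)] True by (simp add: le_def)
    from ustar_mono[OF this s] u True show ?thesis by simp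
  next
    case False
    have L: "root D \<in> labels G"
      using ev_root_label[OF ev_NT1.hyps(2) items_rhs_ok[OF C(1)] False] .
    have "le C ?n" using ev.ev_NT1[OF ev_NT1.hyps(1) _ ev_Hole] by (simp add: le_def)
    then have "ustar ?n C (root D) (Leaf Hole) (root D)" by (simp add: ustar_def)
    with IHC[OF items_N1[OF C(3)] L] False have f: "first_up ?n (root D) D" by fastforce
    have "root t \<in> labels G"
      using ev_root_label[OF ev_NT1.hyps(3) items_rhs_ok[OF s] t] .
    then have "(g, s, root t, \<sigma>') \<in> ssyms G" using g s by (simp add: ssyms_def)
    from up_call[OF f _ this] u False show ?thesis by (simp add: root_fill ustar_def)
  qed
  show ?case
  proof (intro conjI impI allI)
    fix g K \<sigma>'
    assume *: "holes ?X = 0" "g \<in> items G" "\<sigma>' \<in> labels G" "ustar g ?X (root (fill D t)) K \<sigma>'"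
    then have "t \<noteq> Leaf Hole" using ht by auto
    from reduce[OF *(4,2,3) this] IHs * show "full G g (fill K (fill D t)) \<sigma>'"
      by (auto simp: fill_assoc)
  next
    fix g K \<sigma>'
    assume *: "holes ?X = 1" "g \<in> items G" "\<sigma>' \<in> labels G" "ustar g ?X (root (fill D t)) K \<sigma>'"
    show "fill D t = Leaf Hole \<or> first_up g \<sigma>' (fill K (fill D t))"
    proof (cases "t = Leaf Hole")
      \<comment> \<open>The argument vanishes, so the spine starts at the hole of \<open>C\<close>.
        The body is then pursued directly under the goal \<open>g\<close>, and the left corner is
        sought inside \<open>C\<close> instead of being deferred to another call.\<close>
      case True
      have "le C ?X" using ev.ev_NT1[OF ev_NT1.hyps(1) _ ev_NT1.hyps(3)] True by (simp add: le_def)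
      from ustar_mono[OF this C(1)] * True IHC[OF *(2,3)] show ?thesis by simp
    next
      case False
      from reduce[OF *(4,2,3) False] IHs * False show ?thesis by (auto simp: fill_assoc)
    qed
  qed
next
  case (ev_Node2 l l' r r' a)
  let ?X = "Node2 (T a) l r"
  have lr: "l \<in> items G" "r \<in> items G" using items_Node2 ev_Node2.prems by blast+
  note IHl = ev_Node2.IH(1)[OF lr(1)] and IHr = ev_Node2.IH(2)[OF lr(2)]
  have a: "T a \<in> labels G" using items_rhs_ok[OF ev_Node2.prems] by (auto simp: labels_def)
  have side: "full G s t (root t)" "root t \<in> labels G"
    if "s \<in> items G" "holes s = 0" "ev G s t"
      and IH: "\<And>g K \<sigma>'. g \<in> items G \<Longrightarrow> \<sigma>' \<in> labels G \<Longrightarrow> ustar g s (root t) K \<sigma>' \<Longrightarrow> full G g (fill K t) \<sigma>'"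
    for s t
  proof -
    have "t \<noteq> Leaf Hole" using ev_holes[OF wf that(3)] that(2) by auto
    then show L: "root t \<in> labels G" using ev_root_label[OF that(3) items_rhs_ok[OF that(1)]] by simp
    show "full G s t (root t)"
      using IH[OF that(1) L, of "Leaf Hole"] by (auto simp: ustar_def le_def)
  qed
  have edge: "ustar g p (root p') (fill K (mk_node dr (T a) (Leaf Hole) q')) \<sigma>'"
    if "p \<in> items G" "q \<in> items G" "holes q = 0" "full G q q' (root q')" "root q' \<in> labels G"
      "mk_node dr (T a) p q = ?X" "p' \<noteq> Leaf Hole" "ev G p p'"
      "ustar g ?X (T a) K \<sigma>'" "g \<in> items G" "\<sigma>' \<in> labels G" for p p' q q' dr g K \<sigma>'
  proof -
    have "ev G ?X (mk_node dr (T a) C t)" if "ev G p C" "ev G q t" for C t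
      using that \<open>mk_node dr (T a) p q = ?X\<close> by (cases dr) (auto intro: ev.intros)
    moreover have "root p' \<in> labels G"
      using ev_root_label[OF that(8) items_rhs_ok[OF that(1)] that(7)] .
    ultimately show ?thesis
      using up_edge[of p q ?X dr "T a" q' "root q'" g K \<sigma>' "root p'"] that
      by (auto simp: ustar_def ssyms_def)
  qed
  have first: "first_up g \<sigma>' (fill K (mk_node dr (T a) (Leaf Hole) q'))"
    if "q \<in> items G" "holes q = 0" "full G q q' (root q')" "root q' \<in> labels G"
      "mk_node dr (T a) p q = ?X" "ev G p (Leaf Hole)" "ustar g ?X (T a) K \<sigma>'" for p q q' dr g K \<sigma>'
  proof -
    have "ev G ?X (mk_node dr (T a) (Leaf Hole) t)" if "ev G q t" for t
      using that \<open>mk_node dr (T a) p q = ?X\<close> \<open>ev G p (Leaf Hole)\<close> by (cases dr) (auto intro: ev.intros)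
    with that show ?thesis unfolding first_up_def by blast
  qed
  show ?case
  proof (intro conjI impI allI)
    fix g K \<sigma>'
    assume *: "holes ?X = 0" "g \<in> items G" "\<sigma>' \<in> labels G" "ustar g ?X (root (Node2 (T a) l' r')) K \<sigma>'"
    have r: "holes r' = 0" "l' \<noteq> Leaf Hole"
      using ev_holes[OF wf ev_Node2.hyps(1)] ev_holes[OF wf ev_Node2.hyps(2)] * by auto
    have "full G r r' (root r')" "root r' \<in> labels G"
      using side[OF lr(2) _ ev_Node2.hyps(2)] IHr * by auto
    \<comment> \<open>Without a hole either child could continue the spine; the left one is chosen.
      With a hole, the spine has to lead to the hole.\<close>
    from edge[OF lr _ this, of Fw l' g K \<sigma>'] have
      "ustar g l (root l') (fill K (Node2 (T a) (Leaf Hole) r')) \<sigma>'"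
      using * ev_Node2.hyps r by auto
    with IHl * have "full G g (fill (fill K (Node2 (T a) (Leaf Hole) r')) l') \<sigma>'" by auto
    then show "full G g (fill K (Node2 (T a) l' r')) \<sigma>'"
      using r by (simp add: fill_assoc[symmetric] fill_no_hole)
  next
    fix g K \<sigma>'
    assume *: "holes ?X = 1" "g \<in> items G" "\<sigma>' \<in> labels G" "ustar g ?X (root (Node2 (T a) l' r')) K \<sigma>'"
    then consider "holes l = 1" "holes r = 0" | "holes l = 0" "holes r = 1" by (auto simp: add_is_1)
    then have "first_up g \<sigma>' (fill K (Node2 (T a) l' r'))"
    proof cases
      case 1
      have r: "holes r' = 0" using ev_holes[OF wf ev_Node2.hyps(2)] 1 by auto
      have f: "full G r r' (root r')" "root r' \<in> labels G"
        using side[OF lr(2) _ ev_Node2.hyps(2)] IHr 1 by auto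
      show ?thesis
      proof (cases "l' = Leaf Hole")
        case True
        with first[OF lr(2) 1(2) f, of Fw l] * ev_Node2.hyps show ?thesis by auto
      next
        case False
        from edge[OF lr 1(2) f, of Fw l' g K \<sigma>'] False * ev_Node2.hyps IHl 1
        have "first_up g \<sigma>' (fill (fill K (Node2 (T a) (Leaf Hole) r')) l')" by auto
        then show ?thesis using r by (simp add: fill_assoc[symmetric] fill_no_hole)
      qed
    next
      case 2
      have l: "holes l' = 0" using ev_holes[OF wf ev_Node2.hyps(1)] 2 by auto
      have f: "full G l l' (root l')" "root l' \<in> labels G"
        using side[OF lr(1) _ ev_Node2.hyps(1)] IHl 2 by auto
      show ?thesis
      proof (cases "r' = Leaf Hole")
        case True
        with first[OF lr(1) 2(1) f, of Bw r] * ev_Node2.hyps show ?thesis by auto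
      next
        case False
        from edge[OF lr(2,1) 2(1) f, of Bw r' g K \<sigma>'] False * ev_Node2.hyps IHr 2
        have "first_up g \<sigma>' (fill (fill K (Node2 (T a) l' (Leaf Hole))) r')" by auto
        then show ?thesis using l by (simp add: fill_assoc[symmetric] fill_no_hole)
      qed
    qed
    then show "Node2 (T a) l' r' = Leaf Hole \<or> first_up g \<sigma>' (fill K (Node2 (T a) l' r'))" by simp
  qed
qed

lemma ev_full:
  assumes "ev G X t" "X \<in> items G" "holes X = 0"
  shows "full G X t (root t)" "root t \<in> labels G"
proof -
  have "t \<noteq> Leaf Hole" using ev_holes[OF wf assms(1)] assms(3) by auto
  then show L: "root t \<in> labels G"
    using ev_root_label[OF assms(1) items_rhs_ok[OF assms(2)]] by simp
  have "ustar X X (root t) (Leaf Hole) (root t)" by (simp add: ustar_def le_def)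
  with ev_spine[OF assms(1,2)] assms L have "full G X (fill (Leaf Hole) t) (root t)" by blast
  then show "full G X t (root t)" by simp
qed

end

section \<open>The CCG of an sCFTG and its soundness\<close>

locale scftg_ccg = scftg G for G :: "('t, 'n) scftg" +
  fixes At :: "nat set" and dec :: "nat \<Rightarrow> ('t, 'n) datom"
  assumes finite_At: "finite At" and dec_At: "dec ` At = datoms G"
begin

definition col :: "nat \<Rightarrow> bool" where "col c = fst (dec c)"
definition ssym :: "nat \<Rightarrow> ('t, 'n) ssym" where "ssym c = fst (snd (dec c))"
definition side :: "nat \<Rightarrow> ('t, 'n) form" where "side c = fst (snd (snd (dec c)))"
definition rlab :: "nat \<Rightarrow> ('t, 'n) sym" where "rlab c = snd (snd (snd (dec c)))"

lemma At_exists: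
  assumes "s \<in> ssyms G" "B \<in> items G" "\<tau> \<in> labels G"
  obtains c where "c \<in> At" "col c = i" "ssym c = s" "side c = B" "rlab c = \<tau>"
proof -
  have "(i, s, B, \<tau>) \<in> dec ` At" using assms by (simp add: dec_At datoms_def)
  then obtain c where "c \<in> At" "dec c = (i, s, B, \<tau>)" by auto
  with that show thesis by (simp add: col_def ssym_def side_def rlab_def)
qed

lemma At_labels:
  assumes "c \<in> At"
  shows "rlab c \<in> labels G" "top_label (ssym c) \<in> labels G"
proof -
  have "dec c \<in> datoms G" using assms dec_At by blast
  then show "rlab c \<in> labels G" "top_label (ssym c) \<in> labels G"
    by (auto simp: datoms_def ssyms_def rlab_def ssym_def top_label_def)
qed

abbreviation args :: "(slash \<times> nat) list \<Rightarrow> (slash \<times> nat cat) list" where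
  "args es \<equiv> map (map_prod id Atom) es"

abbreviation stack :: "(slash \<times> nat) list \<Rightarrow> ('t, 'n) ssym list" where
  "stack es \<equiv> rev (map (ssym \<circ> snd) es)"

text \<open>Two is the bound on pushed symbols from \<open>valid_step\<close>. The colour condition
  certifies that a category with target \<open>c\<close> and arguments \<open>es\<close> has emptied
  its own stack, so its side tree is complete.\<close>

definition handed :: "nat \<Rightarrow> (slash \<times> nat) list \<Rightarrow> bool" where
  "handed c es \<longleftrightarrow> set es \<subseteq> UNIV \<times> At \<and> length es \<le> 2 \<and> (\<forall>e \<in> set es. col (snd e) = col c)"

text \<open>The consumed argument \<open>c\<close> is also the target of the secondary category, so
  the combination itself enforces the announced side tree. Since \<open>col a\<close> differs from
  \<open>col c\<close>, the arguments \<open>es\<close> become stack symbols of the spine of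
  \<open>a\<close>.\<close>

definition drules :: "nat ccg_rule set" where
  "drules = {(dr, a, Some (Atom c), map (map_prod id (Some \<circ> Atom)) es) | dr a c es.
     a \<in> At \<and> c \<in> At \<and> handed c es \<and> col a \<noteq> col c \<and>
     (\<exists>\<sigma>. valid_step G (ssym c) dr (side c) (stack es) \<sigma>)}"

text \<open>The first family covers spines that consist of one leaf. The second places above
  \<open>es\<close> the initial stack symbol, which leads from the leaf to the announced root
  label.\<close>

definition dlex :: "(nat \<times> nat cat) set" where
  "dlex = {(0, app_args (Atom a) (args es)) | a es. a \<in> At \<and> handed a es \<and>
       (\<exists>s. ev G (side a) (Leaf (T s)) \<and> rlab a = T s)} \<union>
     {(0, app_args (Atom a) (args (es @ [(d, e)]))) | a es d e. a \<in> At \<and> handed a es \<and>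
       e \<in> At \<and> col e \<noteq> col a \<and> (\<exists>s. ssym e = (side a, Leaf (T s), T s, rlab a))}"

definition dccg :: "(nat, nat) ccg" where
  "dccg = \<lparr>inp = {0}, atoms = At, rules = drules,
     init = {a \<in> At. side a = Leaf (NT (start G))}, lex = dlex\<rparr>"

text \<open>A last argument of the other colour is the top of the stack and carries the label of the
  node. Otherwise the stack is empty, the node is the top of its spine, and its label is the one
  announced in the target.\<close>

definition lab :: "nat cat \<Rightarrow> ('t, 'n) sym" where
  "lab c = (case last_arg c of
     Some (_, Atom e) \<Rightarrow> if col e \<noteq> col (target c) then top_label (ssym e) else rlab (target c)
   | _ \<Rightarrow> rlab (target c))"

lemma args_inject: "args xs = args ys \<longleftrightarrow> xs = ys"
  by (rule inj_map_eq_map) (auto simp: inj_def map_prod_def split: prod.splits)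

lemma lab_app_args:
  "lab (app_args (Atom a) (args es)) =
     (if es \<noteq> [] \<and> col (snd (last es)) \<noteq> col a then top_label (ssym (snd (last es))) else rlab a)"
  by (cases es rule: rev_cases) (auto simp: lab_def split: prod.splits)

lemma lab_chain:
  assumes "chain \<sigma> (stack st) (rlab a)" "\<forall>e \<in> set fo. col (snd e) = col a"
    "\<forall>e \<in> set st. col (snd e) \<noteq> col a"
  shows "lab (app_args (Atom a) (args (fo @ st))) = \<sigma>"
proof (cases st rule: rev_cases)
  case Nil
  with assms show ?thesis unfolding lab_app_args by (cases fo rule: rev_cases) auto
next
  case (snoc st' e)
  with assms show ?thesis unfolding lab_app_args by auto
qed

lemma wf_dccg: "wf_ccg dccg"
proof -
  let ?E = "{es. set es \<subseteq> (UNIV :: slash set) \<times> At \<and> length es \<le> 2}"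
  have UN: "(UNIV :: slash set) = {FSl, BSl}" "(UNIV :: dir set) = {Fw, Bw}"
    using slash.exhaust dir.exhaust by blast+
  have "finite ((UNIV :: slash set) \<times> At)" using finite_At by (simp add: UN)
  then have E: "finite ?E" by (rule finite_lists_length_le)
  have r: "drules \<subseteq> (\<lambda>(dr, a, c, es). (dr, a, Some (Atom c), map (map_prod id (Some \<circ> Atom)) es)) `
      (UNIV \<times> At \<times> At \<times> ?E)"
    unfolding drules_def handed_def by (auto simp: image_iff) blast+
  have l: "dlex \<subseteq> (\<lambda>(a, es). (0, app_args (Atom a) (args es))) ` (At \<times> ?E) \<union>
      (\<lambda>(a, es, d, e). (0, app_args (Atom a) (args (es @ [(d, e)])))) ` (At \<times> ?E \<times> UNIV \<times> At)"
    unfolding dlex_def handed_def by (auto simp: image_iff)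
  have A: "x \<in> At" if "x \<in> cat_atoms (app_args (Atom a) (args es))" "a \<in> At" "set es \<subseteq> UNIV \<times> At" for x a es
    using that by (induction es rule: rev_induct) auto
  moreover have "x \<in> At" if "x \<in> cat_atoms (app_args (Atom a) (args (es @ [(d, e)])))" "a \<in> At"
      "set es \<subseteq> UNIV \<times> At" "e \<in> At" for x a es d e
    using A[OF that(1,2)] that(3,4) by simp
  ultimately have "s = 0 \<and> cat_atoms c \<subseteq> At" if "(s, c) \<in> dlex" for s c
    using that unfolding dlex_def handed_def by (auto simp del: map_append app_args_append)
  then have "\<forall>(s, c) \<in> lex dccg. s \<in> inp dccg \<and> cat_atoms c \<subseteq> atoms dccg"
    unfolding dccg_def by auto
  moreover have "finite drules" by (rule finite_subset[OF r]) (use E finite_At in \<open>simp add: UN\<close>)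
  moreover have "finite dlex" by (rule finite_subset[OF l]) (use E finite_At in \<open>simp add: UN\<close>)
  moreover have B: "y \<in> At" if "(x, y) \<in> set es" "set es \<subseteq> UNIV \<times> At" for x y and es :: "(slash \<times> nat) list"
    using that by auto
  have "\<forall>rl \<in> rules dccg. rule_atoms rl \<subseteq> atoms dccg"
    unfolding dccg_def drules_def handed_def rule_atoms_def by auto (erule (1) B)+
  ultimately show ?thesis unfolding wf_ccg_def using finite_At by (auto simp: dccg_def)
qed

lemma rule_inst_drules:
  "(\<exists>rl \<in> drules. rule_inst rl dr a c' es') \<longleftrightarrow>
   (\<exists>c es. c' = Atom c \<and> es' = args es \<and> a \<in> At \<and> c \<in> At \<and> handed c es \<and> col a \<noteq> col c \<and>
     (\<exists>\<sigma>. valid_step G (ssym c) dr (side c) (stack es) \<sigma>))"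
  (is "?l = ?r")
proof
  assume ?l
  then obtain rl where rl: "rl \<in> drules" "rule_inst rl dr a c' es'" by blast
  from rl(1) obtain dr1 a1 c es where
    rl1: "rl = (dr1, a1, Some (Atom c), map (map_prod id (Some \<circ> Atom)) es)"
    and cond: "a1 \<in> At" "c \<in> At" "handed c es" "col a1 \<noteq> col c"
      "\<exists>\<sigma>. valid_step G (ssym c) dr1 (side c) (stack es) \<sigma>"
    unfolding drules_def by blast
  have *: "dr1 = dr" "a1 = a" "c' = Atom c" "map fst es' = map fst es"
    "\<forall>i < length es. snd (es' ! i) = Atom (snd (es ! i))"
    using rl(2) unfolding rule_inst_def rl1 by auto
  have l: "length es' = length es" using *(4) by (metis length_map)
  have "es' = args es"
  proof (rule nth_equalityI)
    fix i assume "i < length es'"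
    then show "es' ! i = args es ! i"
      using *(4,5) l by (metis (no_types, lifting) eq_fst_iff id_apply map_prod_simp nth_map prod.collapse)
  qed (simp add: l)
  with * cond show ?r by blast
next
  assume ?r
  then obtain c es where *: "c' = Atom c" "es' = args es" "a \<in> At" "c \<in> At" "handed c es" "col a \<noteq> col c"
    "\<exists>\<sigma>. valid_step G (ssym c) dr (side c) (stack es) \<sigma>" by blast
  then have "(dr, a, Some (Atom c), map (map_prod id (Some \<circ> Atom)) es) \<in> drules"
    unfolding drules_def by blast
  moreover have "rule_inst (dr, a, Some (Atom c), map (map_prod id (Some \<circ> Atom)) es) dr a c' es'"
    unfolding rule_inst_def by (auto simp: *(1,2))
  ultimately show ?l by blast
qed

lemma map_rtree_mk_node: "map_rtree f (mk_node dr x p q) = mk_node dr (f x) (map_rtree f p) (map_rtree f q)"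
  by (cases dr) auto

text \<open>\<open>fo\<close> collects the arguments to be handed over, \<open>st\<close> the stack
  of the spine itself. Colours make the split unambiguous in a step: the consumed argument must lie
  in \<open>st\<close> of the primary category, and the secondary category must have an empty
  \<open>st\<close>, so that \<open>good\<close> collapses to \<open>ev\<close> for the side
  tree.\<close>

lemma dccg_sound:
  assumes "ccg_deriv dccg d"
  shows "\<exists>a fo st. root d = app_args (Atom a) (args (fo @ st)) \<and> a \<in> At \<and>
    (\<forall>e \<in> set fo. col (snd e) = col a) \<and> (\<forall>e \<in> set st. e \<in> UNIV \<times> At \<and> col (snd e) \<noteq> col a) \<and>
    chain (lab (root d)) (stack st) (rlab a) \<and> good G (side a) (stack st) (map_rtree lab d)"
  using assms
proof (induction rule: ccg_deriv_stack_induct)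
  case (lex s c)
  then have "(s, c) \<in> dlex" by (simp add: dccg_def)
  then consider
      (1) a es s where "c = app_args (Atom a) (args es)" "a \<in> At" "handed a es"
        "ev G (side a) (Leaf (T s))" "rlab a = T s"
    | (2) a es d e s where "c = app_args (Atom a) (args (es @ [(d, e)]))" "a \<in> At" "handed a es"
        "e \<in> At" "col e \<noteq> col a" "ssym e = (side a, Leaf (T s), T s, rlab a)"
    unfolding dlex_def by blast
  then show ?case
  proof cases
    case 1
    have "lab c = T s" unfolding 1(1) lab_app_args using 1 last_in_set[of es] by (auto simp: handed_def)
    with 1 show ?thesis by (intro exI[of _ a] exI[of _ es] exI[of _ "[]"]) (auto simp: handed_def)
  next
    case 2
    have "lab c = T s" unfolding 2(1) lab_app_args using 2 by (simp add: top_label_def)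
    moreover have "good G (side a) [(side a, Leaf (T s), T s, rlab a)] (Leaf (T s))"
      by simp (metis ev_T fill_Hole)
    ultimately show ?thesis using 2
      by (intro exI[of _ a] exI[of _ es] exI[of _ "[(d, e)]"])
        (auto simp: handed_def top_label_def out_label_def)
  qed
next
  case (step p q rl dr a c' es' x)
  from step.hyps(3) have "rl \<in> drules" by (simp add: dccg_def)
  with step.hyps(4) rule_inst_drules[of dr a c' es'] obtain c es \<sigma> where
    c: "c' = Atom c" "es' = args es" "a \<in> At" "c \<in> At" "handed c es" "col a \<noteq> col c"
      "valid_step G (ssym c) dr (side c) (stack es) \<sigma>" by blast
  from step.IH(1) obtain b fo st where p: "root p = app_args (Atom b) (args (fo @ st))"
    "\<forall>e \<in> set fo. col (snd e) = col b" "\<forall>e \<in> set st. e \<in> UNIV \<times> At \<and> col (snd e) \<noteq> col b"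
    "chain (lab (root p)) (stack st) (rlab b)" "good G (side b) (stack st) (map_rtree lab p)" by blast
  have eq: "b = a" "args (fo @ st) = x @ [(slash_of dr, Atom c)]"
    using p(1) step.hyps(5) c(1) unfolding p(1) by (simp_all only: app_args_inject)
  have "st \<noteq> []"
  proof
    assume "st = []"
    with eq(2) obtain fo' where "fo = fo' @ [(slash_of dr, c)]"
      by (cases fo rule: rev_cases) auto
    with p(2) eq(1) c(6) show False by simp
  qed
  then obtain st' where st: "st = st' @ [(slash_of dr, c)]" "x = args (fo @ st')"
    using eq(2) by (cases st rule: rev_cases) auto
  from step.IH(2) obtain b2 fo2 st2 where q: "root q = app_args (Atom b2) (args (fo2 @ st2))"
    "\<forall>e \<in> set fo2. col (snd e) = col b2" "\<forall>e \<in> set st2. col (snd e) \<noteq> col b2"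
    "good G (side b2) (stack st2) (map_rtree lab q)" by blast
  have "b2 = c" "args (fo2 @ st2) = args es"
    using step.hyps(6) c(1,2) unfolding q(1) by (simp_all only: app_args_inject)
  then have eq2: "b2 = c" "es = fo2 @ st2" unfolding args_inject by auto
  have "st2 = []" using q(3) c(5) eq2 by (cases st2) (auto simp: handed_def)
  with q(4) eq2 have q': "ev G (side c) (map_rtree lab q)" by simp
  obtain g X s so where sc: "ssym c = (g, X, s, so)" by (cases "ssym c")
  have v: "holes (side c) = 0" "chain \<sigma> (stack es) so"
    "\<And>C t. ev G X C \<Longrightarrow> ev G (side c) t \<Longrightarrow> good G g (stack es) (mk_node dr \<sigma> C t)"
    using c(7) by (auto simp: valid_step_def sc)
  from p(5) obtain C u where C: "map_rtree lab p = fill C u" "ev G X C"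
    "\<And>C'. ev G g C' \<Longrightarrow> good G (side a) (stack st') (fill C' u)"
    by (auto simp: st sc eq)
  have h: "holes (map_rtree lab q) = 0" using ev_holes[OF wf q'] v(1) by simp
  have "good G (side a) (stack es @ stack st') (fill (mk_node dr \<sigma> C (map_rtree lab q)) u)"
    by (rule good_append[OF v(3)[OF C(2) q'] C(3)])
  then have good: "good G (side a) (stack (st' @ es)) (mk_node dr \<sigma> (map_rtree lab p) (map_rtree lab q))"
    using h C(1) by (simp add: fill_mk_node)
  have "chain so (stack st') (rlab a)" using p(4) by (simp add: st sc eq out_label_def)
  then have chain: "chain \<sigma> (stack (st' @ es)) (rlab a)" using chain_append[OF v(2)] by simp
  have cols: "\<forall>e \<in> set (st' @ es). e \<in> UNIV \<times> At \<and> col (snd e) \<noteq> col a"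
    using p(3) c(5,6) by (auto simp: st eq handed_def)
  have lab: "lab (app_args (Atom a) (args (fo @ st' @ es))) = \<sigma>"
    by (rule lab_chain[OF chain]) (use p(2) eq cols in auto)
  have xe: "x @ es' = args (fo @ st' @ es)" by (simp add: st c(2))
  have fo: "\<forall>e \<in> set fo. col (snd e) = col a" using p(2) eq(1) by simp
  show ?case
    unfolding xe root_mk_node map_rtree_mk_node lab
    by (intro exI[of _ a] exI[of _ fo] exI[of _ "st' @ es"] conjI refl c(3) chain good cols fo)
qed

section \<open>Completeness of the CCG\<close>

definition derives :: "nat cat \<Rightarrow> ('t, 'n) form \<Rightarrow> bool" where
  "derives c t \<longleftrightarrow> (\<exists>d. ccg_deriv dccg d \<and> root d = c \<and> map_rtree lab d = t)"

lemma derives_leaf: "(0, c) \<in> dlex \<Longrightarrow> derives c (Leaf (lab c))"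
  unfolding derives_def by (intro exI[of _ "Leaf c"]) (auto simp: dccg_def intro: ccg_deriv.leaf)

lemma derives_step:
  assumes "derives (app_args (Atom a) (x @ [(slash_of dr, Atom c)])) t" "derives (app_args (Atom c) (args es)) t'"
    "a \<in> At" "c \<in> At" "handed c es" "col a \<noteq> col c" "valid_step G (ssym c) dr (side c) (stack es) \<sigma>"
  shows "derives (app_args (Atom a) (x @ args es)) (mk_node dr (lab (app_args (Atom a) (x @ args es))) t t')"
proof -
  from rule_inst_drules[of dr a "Atom c" "args es"] assms obtain rl
    where rl: "rl \<in> rules dccg" "rule_inst rl dr a (Atom c) (args es)" by (auto simp: dccg_def)
  from assms(1,2) obtain p q where
    p: "ccg_deriv dccg p" "root p = app_args (Atom a) (x @ [(slash_of dr, Atom c)])" "map_rtree lab p = t"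
    and q: "ccg_deriv dccg q" "root q = app_args (Atom c) (args es)" "map_rtree lab q = t'"
    unfolding derives_def by blast
  from ccg_deriv_step[OF p(1) q(1) rl p(2) q(2)] p q show ?thesis
    unfolding derives_def by (metis map_rtree_mk_node root_mk_node)
qed

lemma lab_chain_args:
  assumes "chain \<sigma> (stack es) (lab (app_args (Atom a) x))" "\<forall>e \<in> set es. col (snd e) \<noteq> col a"
  shows "lab (app_args (Atom a) (x @ args es)) = \<sigma>"
proof (cases es rule: rev_cases)
  case (snoc es' e)
  with assms show ?thesis by (cases e) (simp add: lab_def)
qed (use assms in simp)

text \<open>The slash \<open>d\<close> and the atom \<open>c\<close> announce the first step of
  \<open>K\<close>: its direction, the form of its side tree and the root label of that tree. They
  depend on \<open>K\<close> but have to serve every \<open>a\<close> and \<open>x\<close> that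
  fit.\<close>

definition consumes :: "bool \<Rightarrow> ('t, 'n) ssym \<Rightarrow> slash \<Rightarrow> nat \<Rightarrow> ('t, 'n) form \<Rightarrow> bool" where
  "consumes i s d c K \<longleftrightarrow> c \<in> At \<and> col c = i \<and> ssym c = s \<and>
    (\<forall>a x t. a \<in> At \<longrightarrow> col a \<noteq> i \<longrightarrow> lab (app_args (Atom a) x) = out_label s \<longrightarrow>
      derives (app_args (Atom a) (x @ [(d, Atom c)])) t \<longrightarrow> derives (app_args (Atom a) x) (fill K t))"

definition consumes_list :: "bool \<Rightarrow> ('t, 'n) ssym list \<Rightarrow> (slash \<times> nat) list \<Rightarrow> ('t, 'n) form \<Rightarrow> bool" where
  "consumes_list i st es K \<longleftrightarrow>
    set es \<subseteq> UNIV \<times> At \<and> (\<forall>e \<in> set es. col (snd e) = i) \<and> stack es = st \<and>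
    (\<forall>a x t \<sigma>. a \<in> At \<longrightarrow> col a \<noteq> i \<longrightarrow> chain \<sigma> st (lab (app_args (Atom a) x)) \<longrightarrow>
      derives (app_args (Atom a) (x @ args es)) t \<longrightarrow> derives (app_args (Atom a) x) (fill K t))"

text \<open>Stack symbols have the colour opposite to their target, and colours alternate from a
  spine to its side trees; hence every run is realised in both colours. In the third part the
  arbitrary \<open>es\<close> are whatever the primary spine is going to receive: they rest below
  the stack of the side tree and never influence its run.\<close>

lemma dccg_complete:
  shows "up G s K \<Longrightarrow> \<forall>i. \<exists>d c. consumes i s d c K"
    and "ups G st K \<Longrightarrow> \<forall>i. \<exists>es. consumes_list i st es K"
    and "full G B t \<tau> \<Longrightarrow> holes t = 0 \<and> (\<forall>c \<in> At. side c = B \<longrightarrow> rlab c = \<tau> \<longrightarrow>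
      (\<forall>es. handed c es \<longrightarrow> derives (app_args (Atom c) (args es)) t))"
proof (induction rule: up_ups_full.inducts)
  case (up_step s dr B st \<sigma> t' \<tau> K)
  show ?case
  proof
    fix i
    obtain g X s1 so where s: "s = (g, X, s1, so)" by (cases s)
    have v: "s \<in> ssyms G" "B \<in> items G" "length st \<le> 2" "chain \<sigma> st so"
      using up_step(1) by (auto simp: valid_step_def s)
    obtain c where c: "c \<in> At" "col c = i" "ssym c = s" "side c = B" "rlab c = \<tau>"
      using At_exists[OF v(1,2) up_step(4)] .
    from up_step(6) obtain es where "consumes_list i st es K" by blast
    then have es: "set es \<subseteq> UNIV \<times> At" "\<forall>e \<in> set es. col (snd e) = i" "stack es = st"
      "\<And>a x t \<sigma>. a \<in> At \<Longrightarrow> col a \<noteq> i \<Longrightarrow> chain \<sigma> st (lab (app_args (Atom a) x)) \<Longrightarrow>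
        derives (app_args (Atom a) (x @ args es)) t \<Longrightarrow> derives (app_args (Atom a) x) (fill K t)"
      unfolding consumes_list_def by blast+
    have len: "length es \<le> 2" using v(3) by (simp add: es(3)[symmetric])
    have h: "handed c es" using es(1,2) len c(2) by (simp add: handed_def)
    have "derives (app_args (Atom a) x) (fill (fill K (mk_node dr \<sigma> (Leaf Hole) t')) t)"
      if a: "a \<in> At" "col a \<noteq> i" "lab (app_args (Atom a) x) = out_label s"
        "derives (app_args (Atom a) (x @ [(slash_of dr, Atom c)])) t" for a x t
    proof -
      have ch: "chain \<sigma> st (lab (app_args (Atom a) x))" using v(4) a(3) by (simp add: s out_label_def)
      have l: "lab (app_args (Atom a) (x @ args es)) = \<sigma>"
        by (rule lab_chain_args) (use ch es(2,3) a(2) in auto)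
      have "derives (app_args (Atom c) (args es)) t'" using up_step(3) c h by blast
      from derives_step[OF a(4) this a(1) c(1) h, of \<sigma>] a(2) c es(3) up_step(1)
      have "derives (app_args (Atom a) (x @ args es)) (mk_node dr \<sigma> t t')" using l by simp
      from es(4)[OF a(1,2) ch this] show ?thesis
        using up_step(3) by (simp add: fill_assoc[symmetric] fill_mk_node)
    qed
    with c(1-3) have "consumes i s (slash_of dr) c (fill K (mk_node dr \<sigma> (Leaf Hole) t'))"
      unfolding consumes_def by blast
    then show "\<exists>d c. consumes i s d c (fill K (mk_node dr \<sigma> (Leaf Hole) t'))" by blast
  qed
next
  case ups_Nil
  show ?case by (intro allI exI[of _ "[]"]) (auto simp: consumes_list_def)
next
  case (ups_Cons s K st K')
  show ?case
  proof
    fix i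
    from ups_Cons(4) obtain es where "consumes_list i st es K'" by blast
    then have es: "set es \<subseteq> UNIV \<times> At" "\<forall>e \<in> set es. col (snd e) = i" "stack es = st"
      "\<And>a x t \<sigma>. a \<in> At \<Longrightarrow> col a \<noteq> i \<Longrightarrow> chain \<sigma> st (lab (app_args (Atom a) x)) \<Longrightarrow>
        derives (app_args (Atom a) (x @ args es)) t \<Longrightarrow> derives (app_args (Atom a) x) (fill K' t)"
      unfolding consumes_list_def by blast+
    from ups_Cons(2) obtain d c where "consumes i s d c K" by blast
    then have c: "c \<in> At" "col c = i" "ssym c = s"
      "\<And>a x t. a \<in> At \<Longrightarrow> col a \<noteq> i \<Longrightarrow> lab (app_args (Atom a) x) = out_label s \<Longrightarrow>
        derives (app_args (Atom a) (x @ [(d, Atom c)])) t \<Longrightarrow> derives (app_args (Atom a) x) (fill K t)"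
      unfolding consumes_def by blast+
    have "derives (app_args (Atom a) x) (fill (fill K' K) t)"
      if a: "a \<in> At" "col a \<noteq> i" "chain \<sigma> (s # st) (lab (app_args (Atom a) x))"
        "derives (app_args (Atom a) (x @ args (es @ [(d, c)]))) t" for a x t \<sigma>
    proof -
      have ch: "chain (out_label s) st (lab (app_args (Atom a) x))" using a(3) by simp
      have l: "lab (app_args (Atom a) (x @ args es)) = out_label s"
        by (rule lab_chain_args) (use ch es(2,3) a(2) in auto)
      have "derives (app_args (Atom a) (x @ args es)) (fill K t)"
        using c(4)[OF a(1,2) l, of t] a(4) by simp
      from es(4)[OF a(1,2) ch this] show ?thesis by (simp add: fill_assoc)
    qed
    then have "consumes_list i (s # st) (es @ [(d, c)]) (fill K' K)"
      unfolding consumes_list_def using c(1-3) es(1-3) by auto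
    then show "\<exists>es. consumes_list i (s # st) es (fill K' K)" by blast
  qed
next
  case (full_leaf B s)
  have "derives (app_args (Atom c) (args es)) (Leaf (T s))"
    if "c \<in> At" "side c = B" "rlab c = T s" "handed c es" for c es
  proof -
    have "(0, app_args (Atom c) (args es)) \<in> dlex" using that full_leaf by (auto simp: dlex_def)
    moreover have "lab (app_args (Atom c) (args es)) = T s"
      unfolding lab_app_args using that last_in_set[of es] by (auto simp: handed_def)
    ultimately show ?thesis using derives_leaf by metis
  qed
  moreover have "holes (Leaf (T s)) = 0" by simp
  ultimately show ?case by blast
next
  case (full_up B s \<tau> K)
  have "derives (app_args (Atom c) (args es)) (fill K (Leaf (T s)))"
    if c: "c \<in> At" "side c = B" "rlab c = \<tau>" "handed c es" for c es
  proof -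
    from full_up(2) obtain d e where "consumes (\<not> col c) (B, Leaf (T s), T s, \<tau>) d e K" by blast
    then have e: "e \<in> At" "col e = (\<not> col c)" "ssym e = (B, Leaf (T s), T s, \<tau>)"
      "\<And>x t. lab (app_args (Atom c) x) = \<tau> \<Longrightarrow>
        derives (app_args (Atom c) (x @ [(d, Atom e)])) t \<Longrightarrow> derives (app_args (Atom c) x) (fill K t)"
      using c(1) by (simp_all add: consumes_def out_label_def)
    have l: "lab (app_args (Atom c) (args es)) = \<tau>"
      unfolding lab_app_args using c last_in_set[of es] by (auto simp: handed_def)
    have "(0, app_args (Atom c) (args (es @ [(d, e)]))) \<in> dlex"
      unfolding dlex_def using c e by blast
    from derives_leaf[OF this] e(2,3) have
      "derives (app_args (Atom c) (args (es @ [(d, e)]))) (Leaf (T s))"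
      unfolding lab_app_args by (simp add: top_label_def)
    with e(4)[OF l] show ?thesis by simp
  qed
  moreover have "holes (fill K (Leaf (T s))) = 0" by (simp add: holes_fill)
  ultimately show ?case by blast
qed

lemma dccg_root_label:
  assumes "ccg_deriv dccg d"
  shows "lab (root d) \<in> labels G"
proof -
  from dccg_sound[OF assms] obtain a st where "a \<in> At" "\<forall>e \<in> set st. e \<in> UNIV \<times> At"
    "chain (lab (root d)) (stack st) (rlab a)" by blast
  then show ?thesis by (cases st rule: rev_cases) (auto dest: At_labels)
qed

text \<open>Numbers encode labels faithfully only on the finite set \<open>labels G\<close>, so
  every label that occurs must be shown to lie there.\<close>

lemma dccg_labels: "ccg_deriv dccg d \<Longrightarrow> c \<in> set_rtree d \<Longrightarrow> lab c \<in> labels G"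
proof (induction rule: ccg_deriv.induct)
  case (leaf s c')
  with dccg_root_label[OF ccg_deriv.leaf[OF leaf(1)]] show ?case by simp
next
  case (bin p q rl c')
  with dccg_root_label[OF ccg_deriv.bin[OF bin(1,2,3,4)]] show ?case by auto
qed

lemma dccg_lang:
  "t \<in> scftg_lang G \<longleftrightarrow>
    (\<exists>d. ccg_deriv dccg d \<and> (\<exists>a \<in> init dccg. root d = Atom a) \<and> map_rtree lab d = map_rtree T t)"
proof
  assume "t \<in> scftg_lang G"
  then have t: "ev G (Leaf (NT (start G))) (map_rtree T t)" by (simp add: scftg_lang_iff_ev[OF wf])
  from ev_full[OF t items_start] have f: "full G (Leaf (NT (start G))) (map_rtree T t) (root (map_rtree T t))"
    and l: "root (map_rtree T t) \<in> labels G" by auto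
  \<comment> \<open>The main spine is nobody's side tree, so for its target only the form and the
    root label matter; any stack symbol completes the atom.\<close>
  define s where "s = (Leaf (NT (start G)) :: ('t, 'n) form, Leaf (NT (start G)) :: ('t, 'n) form,
    root (map_rtree T t) :: ('t, 'n) sym, root (map_rtree T t) :: ('t, 'n) sym)"
  have "s \<in> ssyms G" using l items_start by (simp add: s_def ssyms_def)
  from At_exists[OF this items_start l] obtain c where
    c: "c \<in> At" "side c = Leaf (NT (start G))" "rlab c = root (map_rtree T t)" by metis
  have "handed c []" by (simp add: handed_def)
  with dccg_complete(3)[OF f] c have "derives (app_args (Atom c) (args [])) (map_rtree T t)" by blast
  with c show "\<exists>d. ccg_deriv dccg d \<and> (\<exists>a \<in> init dccg. root d = Atom a) \<and> map_rtree lab d = map_rtree T t"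
    by (auto simp: derives_def dccg_def)
next
  assume "\<exists>d. ccg_deriv dccg d \<and> (\<exists>a \<in> init dccg. root d = Atom a) \<and> map_rtree lab d = map_rtree T t"
  then obtain d a where d: "ccg_deriv dccg d" "a \<in> At" "side a = Leaf (NT (start G))" "root d = Atom a"
    "map_rtree lab d = map_rtree T t" by (auto simp: dccg_def)
  from dccg_sound[OF d(1)] obtain b fo st where *: "root d = app_args (Atom b) (args (fo @ st))"
    "good G (side b) (stack st) (map_rtree lab d)" by blast
  have "app_args (Atom a) [] = app_args (Atom b) (args (fo @ st))" using *(1) d(4) by simp
  then have "b = a" "st = []" unfolding app_args_inject by auto
  with * d have "ev G (Leaf (NT (start G))) (map_rtree T t)" by simp
  moreover have "no_unary (map_rtree f d') = no_unary d'" for f :: "'x \<Rightarrow> 'y" and d'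
    by (induction d') auto
  then have "no_unary t" using ccg_deriv_no_unary[OF d(1)] d(5) by metis
  ultimately show "t \<in> scftg_lang G" by (simp add: scftg_lang_iff_ev[OF wf])
qed

end

section \<open>Encoding the labels by natural numbers\<close>

lemma scftg_to_ccg:
  fixes G :: "('t, 'n) scftg"
  assumes wf: "wf_scftg G"
  shows "\<exists>(G' :: (nat, nat) ccg) (\<rho> :: nat cat \<Rightarrow> nat) (\<pi> :: nat \<Rightarrow> 't).
    wf_ccg G' \<and> cat_relabeling \<rho> \<and> map_rtree \<pi> ` ccg_lang G' \<rho> = scftg_lang G"
proof -
  interpret scftg G by standard (rule wf)
  from finite_imp_nat_seg_image_inj_on[OF finite_datoms] obtain n :: nat and dec
    where dec: "datoms G = dec ` {i. i < n}" by blast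
  interpret scftg_ccg G "{i. i < n}" dec by standard (auto simp: dec)
  from finite_imp_inj_to_nat_seg[OF finite_labels] obtain enc :: "('t, 'n) sym \<Rightarrow> nat"
    where enc: "inj_on enc (labels G)" by blast
  define \<pi> :: "nat \<Rightarrow> 't" where "\<pi> k = (THE a. inv_into (labels G) enc k = T a)" for k
  have \<pi>: "\<pi> (enc (T a)) = a" if "T a \<in> labels G" for a
    using that by (simp add: \<pi>_def inv_into_f_f[OF enc])
  define \<rho> where "\<rho> = enc \<circ> lab"
  have T: "\<exists>a. l = T a" if "l \<in> labels G" for l using that by (auto simp: labels_def)
  have lab: "T (\<pi> (\<rho> c)) = lab c" if "lab c \<in> labels G" for c
    using T[OF that] that \<pi> by (auto simp: \<rho>_def)
  have "\<forall>c \<in> set_rtree d. lab c \<in> labels G" if "ccg_deriv dccg d" for d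
    using dccg_labels[OF that] by blast
  then have eq: "map_rtree T (map_rtree \<pi> (map_rtree \<rho> d)) = map_rtree lab d" if "ccg_deriv dccg d" for d
    using that lab by (auto simp: rtree.map_comp intro!: rtree.map_cong0)
  have inj: "map_rtree T s = map_rtree T t \<longleftrightarrow> s = t" for s t :: "'t rtree"
    using rtree.inj_map[of T] by (auto simp: inj_def)
  have "map_rtree \<pi> ` ccg_lang dccg \<rho> = scftg_lang G"
  proof (intro equalityI subsetI)
    fix t assume "t \<in> map_rtree \<pi> ` ccg_lang dccg \<rho>"
    then show "t \<in> scftg_lang G" unfolding dccg_lang ccg_lang_def using eq by fastforce
  next
    fix t assume "t \<in> scftg_lang G"
    then obtain d where d: "ccg_deriv dccg d" "\<exists>a \<in> init dccg. root d = Atom a" "map_rtree lab d = map_rtree T t"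
      unfolding dccg_lang by blast
    then have "t = map_rtree \<pi> (map_rtree \<rho> d)" using eq[OF d(1)] inj by metis
    with d show "t \<in> map_rtree \<pi> ` ccg_lang dccg \<rho>" unfolding ccg_lang_def by blast
  qed
  moreover have "lab c = lab c'" if "target c = target c'" "last_arg c = last_arg c'" for c c'
    unfolding lab_def that by (rule refl)
  then have "cat_relabeling \<rho>" unfolding cat_relabeling_def \<rho>_def by (metis comp_apply)
  ultimately show ?thesis using wf_dccg by blast
qed

theorem theorem8p2:
  shows "(\<forall>(G :: ('a, 'b) ccg) (\<rho> :: 'b cat \<Rightarrow> 'c).
            wf_ccg G \<and> cat_relabeling \<rho> \<longrightarrow>
            (\<exists>(G' :: (nat, nat) scftg) (\<pi> :: nat \<Rightarrow> 'c).
               wf_scftg G' \<and> map_rtree \<pi> ` scftg_lang G' = ccg_lang G \<rho>))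
       \<and> (\<forall>G :: ('t, 'n) scftg.
            wf_scftg G \<longrightarrow>
            (\<exists>(G' :: (nat, nat) ccg) (\<rho> :: nat cat \<Rightarrow> nat) (\<pi> :: nat \<Rightarrow> 't).
               wf_ccg G' \<and> cat_relabeling \<rho> \<and>
               map_rtree \<pi> ` ccg_lang G' \<rho> = scftg_lang G))"
  using ccg_to_scftg scftg_to_ccg by blast

end
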